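(* Let $N\ge 3$ be an integer, let $q>N$, and let $f:\mathbb{R}\to[0,+\infty)$ satisfy $(f_1)$ (stated in the context) with this exponent $q$; let $F(s)=\int_0^sf(\tau)\,d\tau$. Then the space $W^{1,N}L^q_{w}(\mathbb{R}^N)$ embeds into the weighted Orlicz space $L_F(\mathbb{R}^N,\log(e+|x|)\,dx)$. More precisely, $$\int_{\mathbb{R}^N}F(\alpha|u|)\log(e+|x|)\,dx<\infty\qquad\text{for all }u\in W^{1,N}L^q_{w}(\mathbb{R}^N)\text{ and all }\alpha>0.$$ Moreover, for every $0<\alpha<\frac Nq\left(\frac{N}{N+1}\right)^{1/N}$ the following uniform bound holds: $$\sup_{\|u\|_{q,w}^N\le1}\int_{\mathbb{R}^N}F(\alpha|u|)\log(e+|x|)\,dx<+\infty,$$ where the supremum is over $u\in W^{1,N}L^q_w(\mathbb{R}^N)$.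
   Context: $\omega_{N-1}$ is the surface measure of the unit sphere in $\mathbb{R}^N$ and $\alpha_N=N\omega_{N-1}^{1/(N-1)}$. $(f_1)$ $f$ is continuous and differentiable on $\mathbb{R}$, and: (i) $f(s)\ge0$ for all $s\ge0$ and $f(s)=0$ for $s\le0$; (ii) for some $C>0$ and $p>0$, $f(s)\le Cs^pe^{\alpha_Ns^{N/(N-1)}}$ as $s\to+\infty$ (i.e. for all large $s$); (iii) $f(s)\asymp s^{q-1}$ as $s\to0^+$ (i.e. the ratio of the two sides is bounded above and below by positive constants near $0^+$). With $w(x)=\log(e+|x|)$, the space $W^{1,N}L^q_{w}(\mathbb{R}^N)$ is the completion of the smooth compactly supported functions with respect to the norm given by $$\|u\|_{q,w}^N=\int_{\mathbb{R}^N}|\nabla u|^N\,dx+\left(\int_{\mathbb{R}^N}|u|^q\log(e+|x|)\,dx\right)^{N/q}.$$ $L_F(\mathbb{R}^N,\log(e+|x|)\,dx)$ is the Orlicz space associated with $F$ and the measure $\log(e+|x|)\,dx$; the meaning of the embedding is made precise by the displayed finiteness and uniform bound. *)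

theory Defs
  imports "HOL-Analysis.Analysis" "HOL-Library.Landau_Symbols"
begin

text \<open>
  Throughout, the Euclidean space \<open>\<real>\<^sup>N\<close> is an arbitrary type \<open>'a\<close> of class
  \<open>euclidean_space\<close>, with \<open>N = DIM('a)\<close>.

  Surface measure on the unit sphere, by polar coordinates: \<open>\<sigma>(A)\<close> is \<open>N\<close> times the
  Lebesgue measure of the cone \<open>{r x | 0 < r \<le> 1, x \<in> A}\<close> over \<open>A\<close>.
\<close>

definition sphere_measure :: "'a::euclidean_space set \<Rightarrow> real" where
  "sphere_measure A =
     real DIM('a) * measure lebesgue {r *\<^sub>R x | r x. 0 < r \<and> r \<le> 1 \<and> x \<in> A}"

definition critical_alpha :: "'a::euclidean_space itself \<Rightarrow> real" where
  "critical_alpha _ =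
     real DIM('a) * sphere_measure (sphere (0::'a) 1) powr (1 / (real DIM('a) - 1))"

definition log_measure :: "'a::euclidean_space measure" where
  "log_measure = density lebesgue (\<lambda>x. ennreal (ln (exp 1 + norm x)))"

primrec C_k :: "nat \<Rightarrow> ('a::euclidean_space \<Rightarrow> real) \<Rightarrow> bool" where
  "C_k 0 g \<longleftrightarrow> continuous_on UNIV g"
| "C_k (Suc k) g \<longleftrightarrow> g differentiable_on UNIV \<and>
     (\<forall>i\<in>Basis. C_k k (\<lambda>x. frechet_derivative g (at x) i))"

definition test_function :: "('a::euclidean_space \<Rightarrow> real) \<Rightarrow> bool" where
  "test_function g \<longleftrightarrow> (\<forall>k. C_k k g) \<and> compact (closure {x. g x \<noteq> 0})"

definition grad :: "('a::euclidean_space \<Rightarrow> real) \<Rightarrow> 'a \<Rightarrow> 'a" where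
  "grad g x = (\<Sum>i\<in>Basis. frechet_derivative g (at x) i *\<^sub>R i)"

text \<open>
  The completion of the test functions is realised as the closure of the graph
  \<open>{(g, grad g) | g test function}\<close> in \<open>L\<^sup>q(log(e+|x|) dx) \<times> L\<^sup>N(dx; \<real>\<^sup>N)\<close>, since
  \<open>g \<mapsto> (g, grad g)\<close> is an isometry for the norm below. An element \<open>(u, G)\<close> thus consists of
  (a representative of) a function \<open>u\<close> and its weak gradient \<open>G\<close>, which \<open>u\<close> determines
  almost everywhere. The convergences force \<open>|u|\<^sup>q\<close> and \<open>|G|\<^sup>N\<close> to be integrable, so
  that the Bochner integrals in the norm have their intended values.
\<close>

definition W_space :: "real \<Rightarrow> (('a::euclidean_space \<Rightarrow> real) \<times> ('a \<Rightarrow> 'a)) set" where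
  "W_space q = {(u, G). u \<in> borel_measurable lebesgue \<and> G \<in> borel_measurable lebesgue \<and>
     (\<exists>\<phi>. (\<forall>n. test_function (\<phi> n)) \<and>
        (\<lambda>n. \<integral>\<^sup>+x. ennreal (\<bar>u x - \<phi> n x\<bar> powr q) \<partial>log_measure) \<longlonglongrightarrow> 0 \<and>
        (\<lambda>n. \<integral>\<^sup>+x. ennreal (norm (G x - grad (\<phi> n) x) ^ DIM('a)) \<partial>lebesgue) \<longlonglongrightarrow> 0)}"

text \<open>The \<open>N\<close>-th power \<open>\<parallel>u\<parallel>\<^sup>N\<close> of the norm, where \<open>G\<close> is the gradient of \<open>u\<close>.\<close>

definition W_norm_pow :: "real \<Rightarrow> ('a::euclidean_space \<Rightarrow> real) \<Rightarrow> ('a \<Rightarrow> 'a) \<Rightarrow> real" where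
  "W_norm_pow q u G =
     (\<integral>x. norm (G x) ^ DIM('a) \<partial>lebesgue) +
     (\<integral>x. \<bar>u x\<bar> powr q \<partial>log_measure) powr (real DIM('a) / q)"

text \<open>
  Set-theoretic Orlicz space; \<open>\<Phi>\<close> is a nonnegative function, not assumed convex.
\<close>

definition orlicz_space :: "'a measure \<Rightarrow> (real \<Rightarrow> real) \<Rightarrow> ('a \<Rightarrow> real) set" where
  "orlicz_space M \<Phi> = {u \<in> borel_measurable M.
     \<exists>c>0. (\<integral>\<^sup>+x. ennreal (\<Phi> (\<bar>u x\<bar> / c)) \<partial>M) < \<infinity>}"

definition cond_f1 :: "nat \<Rightarrow> real \<Rightarrow> real \<Rightarrow> (real \<Rightarrow> real) \<Rightarrow> bool" where
  "cond_f1 N a q f \<longleftrightarrow>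
     continuous_on UNIV f \<and> f differentiable_on UNIV \<and>
     (\<forall>s\<ge>0. f s \<ge> 0) \<and> (\<forall>s\<le>0. f s = 0) \<and>
     (\<exists>C>0. \<exists>p>0. \<forall>\<^sub>F s in at_top.
        f s \<le> C * s powr p * exp (a * s powr (real N / (real N - 1)))) \<and>
     f \<in> \<Theta>[at_right 0](\<lambda>s. s powr (q - 1))"

end

theory Submission
  imports Defs
begin

text \<open>
  For a test function \<open>u\<close> and a radius \<open>r\<close>, \<open>\<bar>u(x)\<bar>\<close> is at most the mean of \<open>\<bar>u\<bar>\<close> over the ball
  of radius \<open>r\<close> around \<open>x\<close> plus \<open>1 / \<omega>\<close> times the integral of \<open>\<bar>\<nabla>u(y)\<bar> \<bar>x - y\<bar>\<^sup>1\<^sup>-\<^sup>N\<close> over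
  that ball. With \<open>r = log(e + \<bar>x\<bar>)\<^sup>-\<^sup>1\<^sup>/\<^sup>N\<close> the mean is bounded by a constant. A weighted Hoelder
  inequality bounds the exponential of the potential, for every exponent strictly below the critical
  one, by \<open>1 + r\<^sup>\<nu> g(x)\<close>, where \<open>g\<close> is the convolution of \<open>\<bar>\<nabla>u\<bar>\<^sup>N\<close> with \<open>\<bar>z\<bar>\<^sup>-\<^sup>\<nu>\<close> truncated
  at \<open>r\<close> and \<open>\<nu> < N\<close>; by Tonelli's theorem the weighted integral of \<open>r\<^sup>\<nu> g\<close> is bounded by that of
  \<open>\<bar>\<nabla>u\<bar>\<^sup>N\<close>. Where \<open>\<bar>u\<bar>\<close> is small, \<open>F(\<alpha>\<bar>u\<bar>)\<close> is controlled by \<open>\<bar>u\<bar>\<^sup>q\<close>. This yields the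
  uniform bound for every \<open>\<alpha> < 1\<close>, and Fatou's lemma extends it to the completion. For arbitrary
  \<open>\<alpha>\<close>, a test function is subtracted from \<open>u\<close> to make the norm small.
\<close>

section \<open>Radial integrals and inequalities\<close>

text \<open>This is why the argument works pointwise, on small balls. The weighted measure is
  infinite, so the summand 1 in the exponential bound cannot be integrated; the exponential is used
  only where \<alpha>|u| is at least 1, and there 1 is at most |u|^q. The growth allowed for f is
  critical at \<alpha> = 1, and the threshold of the theorem is at most 1. The resulting gap
  replaces a sharp inequality: it pays for the power factor in the growth of f, for the mean of |u|,
  for the weight in Hoelder's inequality and for approximants whose norm slightly exceeds 1. The
  exponents balance because, with w the weight, w r^\<nu> = w^(1-\<nu>/N), while the kernel
  |z|^-\<nu> integrates over a ball of radius r to a multiple of r^(N-\<nu>) =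
  w^-(1-\<nu>/N).\<close>

lemma powr_add_le:
  fixes a b p t :: real
  assumes "a \<ge> 0" "b \<ge> 0" "t > 0" "p \<ge> 0"
  shows "(a + b) powr p \<le> (1 + t) powr p * a powr p + (1 + 1 / t) powr p * b powr p"
\<comment> \<open>Whichever of \<open>t * a\<close> and \<open>b\<close> is larger absorbs the
  other, so no convexity enters. A small \<open>t\<close> keeps the coefficient of
  \<open>a powr p\<close> near 1, and all the loss falls on \<open>b\<close>.\<close>
proof (cases "b \<le> t * a")
  case True
  have "(a + b) powr p \<le> ((1 + t) * a) powr p"
    using assms True by (intro powr_mono2) (auto simp: algebra_simps)
  also have "\<dots> = (1 + t) powr p * a powr p"
    using assms by (simp add: powr_mult)
  finally show ?thesis
    by (rule add_increasing2[rotated]) simp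
next
  case False
  have "(a + b) powr p \<le> ((1 + 1 / t) * b) powr p"
    using assms False by (intro powr_mono2) (auto simp: field_simps)
  also have "\<dots> = (1 + 1 / t) powr p * b powr p"
    using assms by (simp add: powr_mult)
  finally show ?thesis
    by (rule add_increasing[rotated]) simp
qed

text \<open>Young's inequality after dividing the factors by \<open>A powr (1 / p)\<close> and
  \<open>B powr (1 / p')\<close>. With positive upper bounds in place of the norms themselves,
  neither zero nor infinite norms need separate treatment.\<close>

lemma nn_integral_Holder:
  fixes f g :: "'a \<Rightarrow> real"
  assumes "p > 1" "p' > 1" "1 / p + 1 / p' = 1"
    and [measurable]: "f \<in> borel_measurable M" "g \<in> borel_measurable M"
    and nn: "\<And>x. x \<in> space M \<Longrightarrow> 0 \<le> f x" "\<And>x. x \<in> space M \<Longrightarrow> 0 \<le> g x"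
    and "A > 0" "B > 0"
    and A: "(\<integral>\<^sup>+x. ennreal (f x powr p) \<partial>M) \<le> ennreal A"
    and B: "(\<integral>\<^sup>+x. ennreal (g x powr p') \<partial>M) \<le> ennreal B"
  shows "(\<integral>\<^sup>+x. ennreal (f x * g x) \<partial>M) \<le> ennreal (A powr (1 / p) * B powr (1 / p'))"
proof -
  define K where "K = A powr (1 / p) * B powr (1 / p')"
  have K: "K > 0" using assms by (simp add: K_def)
  have pp: "p > 0" "p' > 0" using assms by auto
  have "f x * g x \<le> K / (p * A) * f x powr p + K / (p' * B) * g x powr p'"
    if "x \<in> space M" for x
  proof -
    have "f x * g x = K * ((f x / A powr (1 / p)) * (g x / B powr (1 / p')))"
      using assms by (simp add: K_def)
    also have "\<dots> \<le> K * ((f x / A powr (1 / p)) powr p / p + (g x / B powr (1 / p')) powr p' / p')"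
      using K assms that nn by (intro mult_left_mono Youngs_inequality) auto
    also have "(f x / A powr (1 / p)) powr p = f x powr p / A"
      using assms that nn by (simp add: powr_divide powr_powr)
    also have "(g x / B powr (1 / p')) powr p' = g x powr p' / B"
      using assms that nn by (simp add: powr_divide powr_powr)
    finally show ?thesis by (simp add: field_simps)
  qed
  then have "(\<integral>\<^sup>+x. ennreal (f x * g x) \<partial>M)
      \<le> (\<integral>\<^sup>+x. ennreal (K / (p * A)) * ennreal (f x powr p)
             + ennreal (K / (p' * B)) * ennreal (g x powr p') \<partial>M)"
    using K assms
    by (intro nn_integral_mono) (auto simp flip: ennreal_mult ennreal_plus intro!: ennreal_leI)
  also have "\<dots> = ennreal (K / (p * A)) * (\<integral>\<^sup>+x. ennreal (f x powr p) \<partial>M)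
      + ennreal (K / (p' * B)) * (\<integral>\<^sup>+x. ennreal (g x powr p') \<partial>M)"
    by (simp add: nn_integral_add nn_integral_cmult)
  also have "\<dots> \<le> ennreal (K / (p * A)) * ennreal A + ennreal (K / (p' * B)) * ennreal B"
    by (intro add_mono mult_left_mono A B) auto
  also have "\<dots> = ennreal (K * (1 / p + 1 / p'))"
    using K assms by (simp add: field_simps flip: ennreal_mult ennreal_plus)
  finally show ?thesis using assms by (simp add: K_def)
qed

text \<open>Polar coordinates for radial functions. A measure on the line is determined by its
  values on the half-lines \<open>{..r}\<close>; here these are volumes of balls, and the density is
  the derivative of the volume in \<open>r\<close>.\<close>

lemma distr_norm_lborel:
  "distr (lborel :: 'a::euclidean_space measure) borel norm =
    density lborel (\<lambda>r. ennreal (DIM('a) * unit_ball_vol DIM('a) * r ^ (DIM('a) - 1)) * indicator {0..} r)"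
    (is "?L = ?R")
proof (rule measure_eqI_generator_eq[where E = "range atMost" and \<Omega> = UNIV and A = "\<lambda>i. {..real i}"])
  show "Int_stable (range atMost :: real set set)"
    by (auto simp: Int_stable_def)
  have *: "emeasure ?L {..r} = (if r < 0 then 0 else ennreal (unit_ball_vol DIM('a) * r ^ DIM('a)))" for r
  proof -
    have "norm -` {..r} = cball (0::'a) r" by auto
    then show ?thesis by (auto simp: emeasure_distr emeasure_cball)
  qed
  have **: "emeasure ?R {..r} = (if r < 0 then 0 else ennreal (unit_ball_vol DIM('a) * r ^ DIM('a)))" for r :: real
  proof -
    have "emeasure ?R {..r} = (\<integral>\<^sup>+x. ennreal (DIM('a) * unit_ball_vol DIM('a) * x ^ (DIM('a) - 1)) * indicator {0..r} x \<partial>lborel)"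
      by (auto simp: emeasure_density intro!: nn_integral_cong split: split_indicator)
    also have "\<dots> = (if r < 0 then 0 else ennreal (unit_ball_vol DIM('a) * r ^ DIM('a)))"
    proof (cases "r < 0")
      case False
      have "(\<integral>\<^sup>+x. ennreal (DIM('a) * unit_ball_vol DIM('a) * x ^ (DIM('a) - 1)) * indicator {0..r} x \<partial>lborel)
         = ennreal (unit_ball_vol DIM('a) * r ^ DIM('a) - unit_ball_vol DIM('a) * 0 ^ DIM('a))"
        using False
        by (intro nn_integral_FTC_Icc)
           (auto intro!: derivative_eq_intros mult_nonneg_nonneg continuous_intros)
      then show ?thesis using False by simp
    qed auto
    finally show ?thesis .
  qed
  show "emeasure ?L X = emeasure ?R X" if "X \<in> range atMost" for X
    using that * ** by auto
  show "sets ?L = sigma_sets UNIV (range atMost)"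
    by (simp add: borel_eq_atMost)
  show "sets ?R = sigma_sets UNIV (range atMost)"
    by (simp add: borel_eq_atMost)
  show "(\<Union>i. {..real i}) = UNIV"
    by (auto simp: real_arch_simple)
  show "emeasure ?L {..real i} \<noteq> \<infinity>" for i
    using * by simp
qed auto

lemma nn_integral_radial:
  fixes f :: "real \<Rightarrow> ennreal"
  assumes [measurable]: "f \<in> borel_measurable borel"
  shows "(\<integral>\<^sup>+x. f (norm (x::'a::euclidean_space)) \<partial>lborel) =
    (\<integral>\<^sup>+r. ennreal (DIM('a) * unit_ball_vol DIM('a) * r ^ (DIM('a) - 1)) * indicator {0..} r * f r \<partial>lborel)"
proof -
  have "(\<integral>\<^sup>+x. f (norm (x::'a)) \<partial>lborel) = (\<integral>\<^sup>+r. f r \<partial>distr (lborel :: 'a measure) borel norm)"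
    by (simp add: nn_integral_distr)
  also have "\<dots> = (\<integral>\<^sup>+r. ennreal (DIM('a) * unit_ball_vol DIM('a) * r ^ (DIM('a) - 1)) * indicator {0..} r * f r \<partial>lborel)"
    unfolding distr_norm_lborel by (rule nn_integral_density) auto
  finally show ?thesis .
qed

lemma nn_integral_radial_shift:
  fixes f :: "real \<Rightarrow> ennreal" and c :: "'a::euclidean_space"
  assumes [measurable]: "f \<in> borel_measurable borel"
  shows "(\<integral>\<^sup>+x. f (norm (x - c)) \<partial>lborel) = (\<integral>\<^sup>+x. f (norm (x::'a)) \<partial>lborel)"
proof -
  have "(\<integral>\<^sup>+x. f (norm (x::'a)) \<partial>lborel) = (\<integral>\<^sup>+x. f (norm x) \<partial>distr lborel borel ((+) (- c)))"
    by (simp only: lborel_distr_plus)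
  also have "\<dots> = (\<integral>\<^sup>+x. f (norm (- c + x)) \<partial>lborel)"
    by (subst nn_integral_distr) auto
  finally show ?thesis by simp
qed

text \<open>The derivative is required only inside the interval, because powers such as
  \<open>s powr (n - \<nu>)\<close> are continuous at 0 but may have an unbounded derivative
  there.\<close>

lemma nn_integral_FTC_interior:
  fixes F f :: "real \<Rightarrow> real"
  assumes "a \<le> b" "continuous_on {a..b} F"
    and "\<And>x. a < x \<Longrightarrow> x < b \<Longrightarrow> (F has_real_derivative f x) (at x)"
    and "\<And>x. a < x \<Longrightarrow> x < b \<Longrightarrow> f x \<ge> 0"
  shows "(\<integral>\<^sup>+x. ennreal (f x) * indicator {a<..<b} x \<partial>lborel) = ennreal (F b - F a)"
proof -
  have "(f has_integral (F b - F a)) {a..b}"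
    using assms by (intro fundamental_theorem_of_calculus_interior)
      (auto simp: has_real_derivative_iff_has_vector_derivative)
  then have "(f has_integral (F b - F a)) {a<..<b}"
    using has_integral_Icc_iff_Ioo by blast
  then show ?thesis
    using assms by (intro nn_integral_has_integral_lebesgue') auto
qed

lemma nn_integral_radial_ball:
  fixes c :: "'a::euclidean_space" and k :: "real \<Rightarrow> real"
  assumes [measurable]: "k \<in> borel_measurable borel"
  shows "(\<integral>\<^sup>+x. ennreal (k (norm (x - c))) * indicator (ball c r) x \<partial>lborel) =
    (\<integral>\<^sup>+s. ennreal (DIM('a) * unit_ball_vol DIM('a) * (s powr (real DIM('a) - 1) * k s)) * indicator {0<..<r} s \<partial>lborel)"
proof -
  define n where "n = real DIM('a)"
  define V where "V = unit_ball_vol n"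
  have V: "V \<ge> 0" unfolding V_def n_def by simp
  have n: "n \<ge> 1" unfolding n_def by (simp add: Suc_leI)
  have "(\<integral>\<^sup>+x. ennreal (k (norm (x - c))) * indicator (ball c r) x \<partial>lborel)
    = (\<integral>\<^sup>+x. (\<lambda>s. ennreal (k s) * indicator {..<r} s) (norm (x - c)) \<partial>lborel)"
    by (intro nn_integral_cong) (auto split: split_indicator simp: dist_norm norm_minus_commute)
  also have "\<dots> = (\<integral>\<^sup>+s. ennreal (n * V * s ^ (DIM('a) - 1)) * indicator {0..} s *
      (ennreal (k s) * indicator {..<r} s) \<partial>lborel)"
    unfolding n_def V_def
    by (subst nn_integral_radial_shift, measurable) (subst nn_integral_radial, auto)
  also have "\<dots> = (\<integral>\<^sup>+s. ennreal (n * V * (s powr (n - 1) * k s)) * indicator {0<..<r} s \<partial>lborel)"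
  \<comment> \<open>The integrands can differ only at 0, which the indicator on the right leaves out
    and where \<open>s ^ 0 = 1\<close> in dimension one.\<close>
  proof (intro nn_integral_cong_AE AE_I)
    show "emeasure lborel {0::real} = 0" by simp
    show "{s \<in> space lborel. ennreal (n * V * s ^ (DIM('a) - 1)) * indicator {0..} s * (ennreal (k s) * indicator {..<r} s)
       \<noteq> ennreal (n * V * (s powr (n - 1) * k s)) * indicator {0<..<r} s} \<subseteq> {0}"
    proof safe
      fix s :: real
      assume *: "ennreal (n * V * s ^ (DIM('a) - 1)) * indicator {0..} s * (ennreal (k s) * indicator {..<r} s)
       \<noteq> ennreal (n * V * (s powr (n - 1) * k s)) * indicator {0<..<r} s"
      show "s = 0"
      proof (rule ccontr)
        assume "s \<noteq> 0"
        with * have s: "0 < s" "s < r" by (auto split: split_indicator_asm)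
        have "s ^ (DIM('a) - 1) = s powr (n - 1)"
          using s unfolding n_def by (subst powr_realpow[symmetric]) (auto simp: of_nat_diff Suc_leI)
        then show False using * s V n by (simp add: mult.assoc flip: ennreal_mult')
      qed
    qed
  qed auto
  finally show ?thesis by (simp add: n_def V_def)
qed

lemma nn_integral_power_kernel:
  fixes c :: "'a::euclidean_space" and \<nu> r :: real
  assumes "r \<ge> 0" "\<nu> < DIM('a)"
  shows "(\<integral>\<^sup>+x. ennreal (norm (x - c) powr - \<nu>) * indicator (ball c r) x \<partial>lborel) =
    ennreal (DIM('a) * unit_ball_vol DIM('a) / (real DIM('a) - \<nu>) * r powr (real DIM('a) - \<nu>))"
proof -
  define n where "n = real DIM('a)"
  define V where "V = unit_ball_vol n"
  have V: "V > 0" unfolding V_def n_def by simp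
  have "(\<integral>\<^sup>+x. ennreal (norm (x - c) powr - \<nu>) * indicator (ball c r) x \<partial>lborel)
    = (\<integral>\<^sup>+s. ennreal (n * V * (s powr (n - 1) * s powr - \<nu>)) * indicator {0<..<r} s \<partial>lborel)"
    unfolding n_def V_def
    by (subst nn_integral_radial_ball[where k = "\<lambda>s. s powr - \<nu>"]) auto
  also have "\<dots> = (\<integral>\<^sup>+s. ennreal (n * V * s powr (n - \<nu> - 1)) * indicator {0<..<r} s \<partial>lborel)"
    by (simp add: algebra_simps flip: powr_add)
  also have "\<dots> = ennreal (n * V / (n - \<nu>) * r powr (n - \<nu>) - n * V / (n - \<nu>) * 0 powr (n - \<nu>))"
    using assms V
    by (intro nn_integral_FTC_interior)
       (auto intro!: derivative_eq_intros continuous_intros continuous_on_powr' simp: n_def)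
  finally show ?thesis by (simp add: n_def V_def)
qed

text \<open>The kernel |z|^-N just fails to be integrable at the centre, and the denominator repairs
  this. In polar coordinates the integrand becomes a multiple of the logarithmic derivative of
  \<open>\<Lambda> + s powr \<mu>\<close>, hence the closed form.\<close>

lemma nn_integral_log_kernel:
  fixes c :: "'a::euclidean_space" and \<mu> \<Lambda> r :: real
  assumes "r \<ge> 0" "\<mu> > 0" "\<Lambda> > 0"
  shows "(\<integral>\<^sup>+x. ennreal (norm (x - c) powr - real DIM('a) / (1 + \<Lambda> * norm (x - c) powr - \<mu>)) * indicator (ball c r) x \<partial>lborel) =
    ennreal (DIM('a) * unit_ball_vol DIM('a) / \<mu> * ln (1 + r powr \<mu> / \<Lambda>))"
proof -
  define n where "n = real DIM('a)"
  define V where "V = unit_ball_vol n"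
  have V: "V > 0" unfolding V_def n_def by simp
  have n: "n \<ge> 1" unfolding n_def by (simp add: Suc_leI)
  have "(\<integral>\<^sup>+x. ennreal (norm (x - c) powr - real DIM('a) / (1 + \<Lambda> * norm (x - c) powr - \<mu>)) * indicator (ball c r) x \<partial>lborel)
    = (\<integral>\<^sup>+s. ennreal (n * V * (s powr (n - 1) * (s powr - n / (1 + \<Lambda> * s powr - \<mu>)))) * indicator {0<..<r} s \<partial>lborel)"
    unfolding n_def V_def
    by (subst nn_integral_radial_ball[where k = "\<lambda>s. s powr - real DIM('a) / (1 + \<Lambda> * s powr - \<mu>)"]) auto
  also have "\<dots> = (\<integral>\<^sup>+s. ennreal (n * V / \<mu> * (\<mu> * s powr (\<mu> - 1) / (\<Lambda> + s powr \<mu>))) * indicator {0<..<r} s \<partial>lborel)"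
  proof (intro nn_integral_cong)
    fix s :: real
    have "s powr (n - 1) * (s powr - n / (1 + \<Lambda> * s powr - \<mu>)) = s powr (\<mu> - 1) / (\<Lambda> + s powr \<mu>)" if "s > 0"
    proof -
      have 1: "s powr (n - 1) * s powr - n = 1 / s"
        using that by (simp add: powr_minus_divide powr_diff)
      have 2: "s powr (\<mu> - 1) = s powr \<mu> / s" "s powr - \<mu> = 1 / s powr \<mu>"
        using that by (simp_all add: powr_diff powr_minus_divide)
      define m where "m = s powr \<mu>"
      have m: "m > 0" using that by (simp add: m_def)
      have "s powr (n - 1) * (s powr - n / (1 + \<Lambda> * s powr - \<mu>)) = (1 / s) / (1 + \<Lambda> / m)"
        using 1 2 by (simp add: m_def)
      also have "\<dots> = (m / s) / (\<Lambda> + m)"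
        using m that assms by (simp add: divide_simps)
      finally show ?thesis using 2 by (simp add: m_def)
    qed
    then have "n * V * (s powr (n - 1) * (s powr - n / (1 + \<Lambda> * s powr - \<mu>)))
        = n * V / \<mu> * (\<mu> * s powr (\<mu> - 1) / (\<Lambda> + s powr \<mu>))" if "s > 0"
      using that assms by (simp only:) simp
    then show "ennreal (n * V * (s powr (n - 1) * (s powr - n / (1 + \<Lambda> * s powr - \<mu>)))) * indicator {0<..<r} s
      = ennreal (n * V / \<mu> * (\<mu> * s powr (\<mu> - 1) / (\<Lambda> + s powr \<mu>))) * indicator {0<..<r} s"
      by (cases "s > 0") simp_all
  qed
  also have "\<dots> = ennreal (n * V / \<mu> * ln (\<Lambda> + r powr \<mu>) - n * V / \<mu> * ln (\<Lambda> + 0 powr \<mu>))"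
  proof (intro nn_integral_FTC_interior)
    have "\<Lambda> + x powr \<mu> > 0" for x using assms by (intro add_pos_nonneg) auto
    then show "continuous_on {0..r} (\<lambda>r. n * V / \<mu> * ln (\<Lambda> + r powr \<mu>))"
      "\<And>s. 0 < s \<Longrightarrow> s < r \<Longrightarrow> ((\<lambda>r. n * V / \<mu> * ln (\<Lambda> + r powr \<mu>)) has_real_derivative
        n * V / \<mu> * (\<mu> * s powr (\<mu> - 1) / (\<Lambda> + s powr \<mu>))) (at s)"
      "\<And>s. 0 < s \<Longrightarrow> s < r \<Longrightarrow> 0 \<le> n * V / \<mu> * (\<mu> * s powr (\<mu> - 1) / (\<Lambda> + s powr \<mu>))"
      using assms V n
      by (auto intro!: derivative_eq_intros continuous_intros continuous_on_powr' simp: less_imp_neq[THEN not_sym] less_imp_le)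
  qed (use assms in auto)
  also have "n * V / \<mu> * ln (\<Lambda> + r powr \<mu>) - n * V / \<mu> * ln (\<Lambda> + 0 powr \<mu>) = n * V / \<mu> * (ln (\<Lambda> + r powr \<mu>) - ln \<Lambda>)"
    using assms by (simp add: algebra_simps)
  also have "ln (\<Lambda> + r powr \<mu>) - ln \<Lambda> = ln ((\<Lambda> + r powr \<mu>) / \<Lambda>)"
    using add_pos_nonneg[OF assms(3) powr_ge_zero[of r \<mu>]] assms by (subst ln_div) auto
  also have "(\<Lambda> + r powr \<mu>) / \<Lambda> = 1 + r powr \<mu> / \<Lambda>"
    using assms by (simp add: field_simps)
  finally show ?thesis by (simp add: n_def V_def)
qed

section \<open>Test functions and the Riesz potential\<close>

lemma nn_integral_affine:
  fixes F :: "'a::euclidean_space \<Rightarrow> ennreal"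
  assumes [measurable]: "F \<in> borel_measurable borel" and "t > 0"
  shows "(\<integral>\<^sup>+z. F (x + t *\<^sub>R z) \<partial>lborel) = ennreal (t powr - real DIM('a)) * (\<integral>\<^sup>+y. F y \<partial>lborel)"
proof -
  have "(\<integral>\<^sup>+y. F y \<partial>lborel) = (\<integral>\<^sup>+y. F y \<partial>density (distr lborel borel (\<lambda>z. x + t *\<^sub>R z)) (\<lambda>_. \<bar>t\<bar>^DIM('a)))"
    using assms by (subst lborel_affine[of t x]) auto
  also have "\<dots> = ennreal (t ^ DIM('a)) * (\<integral>\<^sup>+z. F (x + t *\<^sub>R z) \<partial>lborel)"
    using assms by (simp add: nn_integral_density nn_integral_distr nn_integral_cmult)
  finally have "ennreal (t powr - real DIM('a)) * (\<integral>\<^sup>+y. F y \<partial>lborel) =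
     ennreal (t powr - real DIM('a)) * ennreal (t ^ DIM('a)) * (\<integral>\<^sup>+z. F (x + t *\<^sub>R z) \<partial>lborel)"
    by (simp add: mult.assoc)
  also have "ennreal (t powr - real DIM('a)) * ennreal (t ^ DIM('a)) = 1"
    using assms by (simp add: powr_minus powr_realpow flip: ennreal_mult)
  finally show ?thesis by simp
qed

section \<open>Calculus of test functions and their gradients\<close>

lemma C_k_linear_combination:
  fixes g h :: "'a::euclidean_space \<Rightarrow> real"
  shows "C_k k g \<Longrightarrow> C_k k h \<Longrightarrow> C_k k (\<lambda>x. a * g x + b * h x)"
proof (induction k arbitrary: g h)
  case 0
  then show ?case by (auto intro!: continuous_intros)
next
  case (Suc k)
  have g: "g differentiable at x" and h: "h differentiable at x" for x
    using Suc.prems by (auto simp: differentiable_on_eq_differentiable_at)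
  have "((\<lambda>x. a * g x + b * h x) has_derivative
      (\<lambda>v. a * frechet_derivative g (at x) v + b * frechet_derivative h (at x) v)) (at x)" for x
    using g[of x] h[of x] unfolding frechet_derivative_works
    by (auto intro!: derivative_eq_intros)
  then have "frechet_derivative (\<lambda>x. a * g x + b * h x) (at x) =
      (\<lambda>v. a * frechet_derivative g (at x) v + b * frechet_derivative h (at x) v)" for x
    by (rule frechet_derivative_at[symmetric])
  moreover have "(\<lambda>x. a * g x + b * h x) differentiable_on UNIV"
    using Suc.prems by (auto intro!: derivative_intros)
  ultimately show ?case using Suc by auto
qed

lemma test_function_differentiable: "test_function g \<Longrightarrow> g differentiable at x"
  unfolding test_function_def
  by (metis C_k.simps(2) UNIV_I differentiable_on_eq_differentiable_at open_UNIV)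

lemma test_function_continuous: "test_function g \<Longrightarrow> continuous_on UNIV g"
  unfolding test_function_def by (metis C_k.simps(1))

lemma test_function_grad_continuous:
  assumes "test_function g" shows "continuous_on UNIV (grad g)"
proof -
  have "C_k (Suc 0) g" using assms unfolding test_function_def by blast
  then show ?thesis
    unfolding grad_def by (auto intro!: continuous_intros)
qed

lemma test_function_has_derivative:
  assumes "test_function g"
  shows "(g has_derivative (\<lambda>v. grad g x \<bullet> v)) (at x)"
proof -
  have D: "(g has_derivative frechet_derivative g (at x)) (at x)"
    using test_function_differentiable[OF assms] by (simp add: frechet_derivative_works)
  then have lin: "linear (frechet_derivative g (at x))"
    by (rule has_derivative_linear)
  have "frechet_derivative g (at x) v = grad g x \<bullet> v" for v
  proof -
    have "frechet_derivative g (at x) v = frechet_derivative g (at x) (\<Sum>i\<in>Basis. (v \<bullet> i) *\<^sub>R i)"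
      by (simp add: euclidean_representation)
    also have "\<dots> = (\<Sum>i\<in>Basis. (v \<bullet> i) * frechet_derivative g (at x) i)"
      using lin by (simp add: linear_sum linear_cmul)
    also have "\<dots> = grad g x \<bullet> v"
      unfolding grad_def inner_sum_left
      by (intro sum.cong refl) (simp add: inner_commute mult.commute)
    finally show ?thesis .
  qed
  then show ?thesis using D by (metis (no_types, lifting) ext)
qed

lemma grad_eqI:
  assumes "(g has_derivative (\<lambda>v. w \<bullet> v)) (at x)"
  shows "grad g x = w"
  using frechet_derivative_at[OF assms] unfolding grad_def
  by (metis (no_types, lifting) euclidean_representation sum.cong)

lemma test_function_linear_combination:
  fixes g h :: "'a::euclidean_space \<Rightarrow> real"
  assumes "test_function g" "test_function h"
  shows "test_function (\<lambda>x. a * g x + b * h x)"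
    and "grad (\<lambda>x. a * g x + b * h x) x = a *\<^sub>R grad g x + b *\<^sub>R grad h x"
proof -
  let ?f = "\<lambda>x. a * g x + b * h x"
  have "compact (closure {x. ?f x \<noteq> 0})"
  proof (rule compact_closure[THEN iffD2], rule bounded_subset)
    show "bounded ({x. g x \<noteq> 0} \<union> {x. h x \<noteq> 0})"
      using assms by (simp add: test_function_def)
  qed auto
  then show "test_function ?f"
    using assms unfolding test_function_def by (auto intro: C_k_linear_combination)
  show "grad ?f x = a *\<^sub>R grad g x + b *\<^sub>R grad h x"
    by (rule grad_eqI)
       (auto intro!: derivative_eq_intros assms[THEN test_function_has_derivative] simp: inner_add_left)
qed

lemma test_function_support:
  fixes g :: "'a::euclidean_space \<Rightarrow> real"
  assumes "test_function g"
  obtains R where "R > 0" "\<And>x. norm x \<ge> R \<Longrightarrow> g x = 0" "\<And>x. norm x \<ge> R \<Longrightarrow> grad g x = 0"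
proof -
  let ?S = "closure {x. g x \<noteq> 0}"
  have "bounded ?S"
    using assms unfolding test_function_def by (intro compact_imp_bounded) (erule conjunct2)
  then obtain R where "R > 0" "\<forall>x\<in>?S. norm x < R"
    unfolding bounded_pos_less by (elim exE conjE)
  then have R: "R > 0" "\<And>x. x \<in> ?S \<Longrightarrow> norm x < R"
    by (simp_all only:)
  show ?thesis
  proof
    fix x :: 'a assume x: "norm x \<ge> R"
    have "x \<notin> ?S"
    proof
      assume "x \<in> ?S"
      then show False using R(2)[of x] x by linarith
    qed
    then have x': "x \<in> - ?S" by (simp only: Compl_iff not_False_eq_True)
    have zero: "g y = 0" if "y \<in> - ?S" for y
    proof (rule ccontr)
      assume "g y \<noteq> 0"
      then have "y \<in> ?S" by (intro subsetD[OF closure_subset]) simp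
      then show False using ComplD[OF that] by contradiction
    qed
    show "g x = 0" using x' by (rule zero)
    \<comment> \<open>The complement of the closed support is open, so \<open>g\<close> vanishes on
      a whole neighbourhood of \<open>x\<close>.\<close>
    have "(g has_derivative (\<lambda>v. 0)) (at x)"
      by (rule has_derivative_transform_within_open[OF has_derivative_const[of 0] _ x'])
         (auto intro: zero[unfolded Compl_iff])
    then show "grad g x = 0" by (intro grad_eqI) simp
  qed fact
qed

lemma nn_integral_compact_support_finite:
  fixes \<phi> :: "'a::euclidean_space \<Rightarrow> real"
  assumes "continuous_on UNIV \<phi>" "\<And>x. norm x \<ge> R \<Longrightarrow> \<phi> x = 0"
  shows "(\<integral>\<^sup>+x. ennreal (\<phi> x) \<partial>lebesgue) < \<infinity>"
proof -
  have "compact (\<phi> ` cball 0 R)"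
    using assms(1) by (intro compact_continuous_image) (auto intro: continuous_on_subset)
  then have "bounded (\<phi> ` cball 0 R)"
    by (rule compact_imp_bounded)
  then obtain M where "\<forall>y\<in>\<phi> ` cball 0 R. norm y \<le> M"
    unfolding bounded_iff by blast
  then have M: "\<And>x. norm x \<le> R \<Longrightarrow> norm (\<phi> x) \<le> M"
    by simp
  have "(\<integral>\<^sup>+x. ennreal (\<phi> x) \<partial>lebesgue) \<le> (\<integral>\<^sup>+x. ennreal M * indicator (cball (0::'a) R) x \<partial>lebesgue)"
  proof (intro nn_integral_mono)
    fix x :: 'a
    show "ennreal (\<phi> x) \<le> ennreal M * indicator (cball 0 R) x"
      using M[of x] assms(2)[of x] by (cases "norm x \<le> R") (auto intro!: ennreal_leI)
  qed
  also have "\<dots> = ennreal M * emeasure lborel (cball (0::'a) R)"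
    by (simp add: nn_integral_completion nn_integral_cmult_indicator)
  also have "\<dots> < \<infinity>"
    using emeasure_bounded_finite[OF bounded_cball, of "0::'a" R] by (simp add: ennreal_mult_less_top)
  finally show ?thesis .
qed

text \<open>The direction \<open>z\<close> is not normalised: it will range over the solid unit ball
  with Lebesgue measure, which is why the factor \<open>norm z\<close> appears.\<close>

lemma ray_bound:
  fixes u :: "'a::euclidean_space \<Rightarrow> real"
  assumes u: "test_function u" and "r > 0"
  shows "ennreal \<bar>u x\<bar> \<le> ennreal \<bar>u (x + r *\<^sub>R z)\<bar> +
    (\<integral>\<^sup>+t. ennreal (norm (grad u (x + t *\<^sub>R z)) * norm z) * indicator {0<..<r} t \<partial>lborel)"
proof -
  let ?h = "\<lambda>t. norm (grad u (x + t *\<^sub>R z)) * norm z"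
  have cont: "continuous_on {0..r} (\<lambda>t. grad u (x + t *\<^sub>R z))"
    by (rule continuous_on_compose2[OF test_function_grad_continuous[OF u]])
       (auto intro!: continuous_intros)
  have 1: "((\<lambda>t. grad u (x + t *\<^sub>R z) \<bullet> z) has_integral (u (x + r *\<^sub>R z) - u (x + 0 *\<^sub>R z))) {0..r}"
  proof (rule fundamental_theorem_of_calculus)
    fix t :: real
    have "((\<lambda>t. u (x + t *\<^sub>R z)) has_derivative (\<lambda>s. grad u (x + t *\<^sub>R z) \<bullet> (s *\<^sub>R z))) (at t)"
      by (rule has_derivative_compose[OF _ test_function_has_derivative[OF u], of "\<lambda>t. x + t *\<^sub>R z"])
         (auto intro!: derivative_eq_intros)
    then show "((\<lambda>t. u (x + t *\<^sub>R z)) has_vector_derivative grad u (x + t *\<^sub>R z) \<bullet> z) (at t within {0..r})"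
      by (simp add: has_vector_derivative_def has_derivative_at_withinI)
  qed (use assms in auto)
  have 2: "(?h has_integral integral {0..r} ?h) {0..r}"
    using cont by (intro integrable_integral integrable_continuous_interval continuous_intros)
  have "norm (integral {0..r} (\<lambda>t. grad u (x + t *\<^sub>R z) \<bullet> z)) \<le> integral {0..r} ?h"
    using 1 2 by (intro integral_norm_bound_integral)
       (auto simp: has_integral_iff Cauchy_Schwarz_ineq2)
  then have "\<bar>u x\<bar> \<le> \<bar>u (x + r *\<^sub>R z)\<bar> + integral {0..r} ?h"
    using integral_unique[OF 1] by simp
  moreover have "(\<integral>\<^sup>+t. ennreal (?h t) * indicator {0<..<r} t \<partial>lborel) = ennreal (integral {0..r} ?h)"
    using 2 by (intro nn_integral_has_integral_lebesgue') (auto simp: has_integral_Icc_iff_Ioo)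
  moreover have "integral {0..r} ?h \<ge> 0"
    by (intro Henstock_Kurzweil_Integration.integral_nonneg) (use 2 in auto)
  ultimately show ?thesis by (simp flip: ennreal_plus)
qed

text \<open>The integral over the scale \<open>t\<close> that \<open>riesz_bound\<close> leaves for
  a fixed point \<open>y\<close> at distance \<open>d\<close> from \<open>x\<close>. Dropping the
  contribution of the end \<open>r\<close> produces the Riesz kernel \<open>d powr (1 - n)\<close>
  and the factor \<open>1 / n\<close>.\<close>

lemma nn_integral_power_Ioo_le:
  fixes d r :: real
  assumes "d \<ge> 0" "n > 0"
  shows "(\<integral>\<^sup>+t. ennreal (d * t powr (- n - 1)) * indicator {d<..<r} t \<partial>lborel) \<le>
    ennreal (d powr (1 - n) / n) * indicator {..<r} d"
proof (cases "0 < d \<and> d < r")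
  case True
  have "(\<integral>\<^sup>+t. ennreal (d * t powr (- n - 1)) * indicator {d<..<r} t \<partial>lborel)
     = ennreal (- d / n * r powr - n - - d / n * d powr - n)"
    using True assms
    by (intro nn_integral_FTC_interior) (auto intro!: derivative_eq_intros continuous_intros)
  also have "\<dots> \<le> ennreal (d powr (1 - n) / n)"
  proof (rule ennreal_leI)
    have "d * d powr - n = d powr (1 - n)"
      using True by (simp add: powr_diff powr_minus_divide)
    moreover have "d / n * r powr - n \<ge> 0" using True assms by simp
    ultimately show "- d / n * r powr - n - - d / n * d powr - n \<le> d powr (1 - n) / n"
      by (simp add: field_simps)
  qed
  finally show ?thesis using True by simp
next
  case False
  have "(\<integral>\<^sup>+t. ennreal (d * t powr (- n - 1)) * indicator {d<..<r} t \<partial>lborel) = (\<integral>\<^sup>+t. 0 \<partial>(lborel :: real measure))"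
    using False assms by (intro nn_integral_cong) (auto split: split_indicator)
  then show ?thesis by simp
qed

text \<open>
  Integrating the fundamental theorem along the rays \<open>x + t z\<close> over all \<open>z\<close> in the unit ball gives
  the Riesz kernel with the sharp constant, without integration over the sphere.
\<close>

lemma riesz_bound:
  fixes u :: "'a::euclidean_space \<Rightarrow> real"
  assumes u: "test_function u" and r: "r > 0"
  shows "ennreal (unit_ball_vol DIM('a) * \<bar>u x\<bar>) \<le>
    (\<integral>\<^sup>+z. ennreal \<bar>u (x + r *\<^sub>R z)\<bar> * indicator (ball 0 1) z \<partial>lborel) +
    ennreal (1 / DIM('a)) *
     (\<integral>\<^sup>+y. ennreal (norm (grad u y) * norm (y - x) powr (1 - real DIM('a))) * indicator (ball x r) y \<partial>lborel)"
proof -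
  define n where "n = real DIM('a)"
  have n: "n > 0" by (simp add: n_def)
  define h where "h = (\<lambda>y. norm (grad u y))"
  have [measurable]: "u \<in> borel_measurable borel" "h \<in> borel_measurable borel"
    using test_function_continuous[OF u] test_function_grad_continuous[OF u]
    by (auto simp: h_def intro!: borel_measurable_continuous_onI continuous_intros)
  have "(\<integral>\<^sup>+z. (\<integral>\<^sup>+t. ennreal (h (x + t *\<^sub>R z) * norm z) * indicator {0<..<r} t \<partial>lborel) * indicator (ball 0 1) z \<partial>lborel)
     = (\<integral>\<^sup>+z. (\<integral>\<^sup>+t. ennreal (h (x + t *\<^sub>R z) * norm z) * indicator {0<..<r} t * indicator (ball 0 1) z \<partial>lborel) \<partial>lborel)"
    by (intro nn_integral_cong nn_integral_multc[symmetric]) simp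
  also have "\<dots> = (\<integral>\<^sup>+t. (\<integral>\<^sup>+z. ennreal (h (x + t *\<^sub>R z) * norm z) * indicator {0<..<r} t * indicator (ball 0 1) z \<partial>lborel) \<partial>lborel)"
  proof (rule lborel_pair.Fubini'[symmetric])
    have "(\<lambda>(z, t). ennreal (h (x + t *\<^sub>R z) * norm z) * indicator {0<..<r} t * indicator (ball 0 1) z)
      = (\<lambda>p. ennreal (h (x + snd p *\<^sub>R fst p) * norm (fst p)) * indicator {0<..<r} (snd p) * indicator {p. norm (fst p) < 1} p)"
      by (auto split: split_indicator)
    also have "\<dots> \<in> borel_measurable (lborel \<Otimes>\<^sub>M lborel)"
      by measurable
    finally show "(\<lambda>(z, t). ennreal (h (x + t *\<^sub>R z) * norm z) * indicator {0<..<r} t * indicator (ball 0 1) z)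
      \<in> borel_measurable (lborel \<Otimes>\<^sub>M lborel)" .
  qed
  \<comment> \<open>Substitution y = x + t z for fixed \<open>t\<close>: the volume element
    contributes t^-n, \<open>norm z\<close> becomes |y - x| / t, and |z| < 1 becomes |y - x| <
    t.\<close>
  also have "\<dots> = (\<integral>\<^sup>+t. (\<integral>\<^sup>+y. ennreal (h y) * (ennreal (norm (y - x) * t powr (- n - 1)) * indicator {norm (y - x)<..<r} t) \<partial>lborel) \<partial>lborel)"
  proof (rule nn_integral_cong)
    fix t :: real
    show "(\<integral>\<^sup>+z. ennreal (h (x + t *\<^sub>R z) * norm z) * indicator {0<..<r} t * indicator (ball 0 1) z \<partial>lborel)
      = (\<integral>\<^sup>+y. ennreal (h y) * (ennreal (norm (y - x) * t powr (- n - 1)) * indicator {norm (y - x)<..<r} t) \<partial>lborel)"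
    proof (cases "0 < t \<and> t < r")
      case True
      define F :: "'a \<Rightarrow> ennreal"
        where "F = (\<lambda>y. ennreal (h y * (norm (y - x) / t)) * indicator (ball x t) y)"
      have [measurable]: "F \<in> borel_measurable borel"
        unfolding F_def by (intro borel_measurable_times_ennreal borel_measurable_indicator) auto
      have "(\<integral>\<^sup>+z. ennreal (h (x + t *\<^sub>R z) * norm z) * indicator {0<..<r} t * indicator (ball 0 1) z \<partial>lborel)
        = (\<integral>\<^sup>+z. F (x + t *\<^sub>R z) \<partial>lborel)"
        using True by (intro nn_integral_cong) (auto split: split_indicator simp: dist_norm F_def)
      also have "\<dots> = ennreal (t powr - n) * (\<integral>\<^sup>+y. F y \<partial>lborel)"
        unfolding n_def by (rule nn_integral_affine) (use True in auto)
      also have "\<dots> = (\<integral>\<^sup>+y. ennreal (t powr - n) * F y \<partial>lborel)"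
        by (simp add: nn_integral_cmult)
      also have "\<dots> = (\<integral>\<^sup>+y. ennreal (h y) * (ennreal (norm (y - x) * t powr (- n - 1)) * indicator {norm (y - x)<..<r} t) \<partial>lborel)"
      proof (rule nn_integral_cong)
        fix y
        have "t powr (- n - 1) = t powr - n / t" using True by (simp add: powr_diff)
        then show "ennreal (t powr - n) * F y = ennreal (h y) * (ennreal (norm (y - x) * t powr (- n - 1)) * indicator {norm (y - x)<..<r} t)"
          using True unfolding F_def h_def
          by (simp add: indicator_def dist_norm norm_minus_commute flip: ennreal_mult)
      qed
      finally show ?thesis .
    next
      case False
      then have "indicator {0<..<r} t = (0::ennreal)"
        and "indicator {norm (y - x)<..<r} t = (0::ennreal)" for y
        using order.strict_trans1[OF norm_ge_zero[of "y - x"]] by (auto simp: indicator_def)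
      then show ?thesis by simp
    qed
  qed
  \<comment> \<open>The order is exchanged back, so that for each \<open>y\<close> only an explicit
    integral over \<open>t\<close> between |y - x| and \<open>r\<close> remains.\<close>
  also have "\<dots> = (\<integral>\<^sup>+y. (\<integral>\<^sup>+t. ennreal (h y) * (ennreal (norm (y - x) * t powr (- n - 1)) * indicator {norm (y - x)<..<r} t) \<partial>lborel) \<partial>lborel)"
  proof (rule lborel_pair.Fubini')
    have "(\<lambda>(y, t). ennreal (h y) * (ennreal (norm (y - x) * t powr (- n - 1)) * indicator {norm (y - x)<..<r} t))
      = (\<lambda>p. ennreal (h (fst p)) * (ennreal (norm (fst p - x) * snd p powr (- n - 1)) * indicator {p. norm (fst p - x) < snd p \<and> snd p < r} p))"
      by (auto split: split_indicator)
    also have "\<dots> \<in> borel_measurable (lborel \<Otimes>\<^sub>M lborel)"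
      by measurable
    finally show "(\<lambda>(y, t). ennreal (h y) * (ennreal (norm (y - x) * t powr (- n - 1)) * indicator {norm (y - x)<..<r} t))
      \<in> borel_measurable (lborel \<Otimes>\<^sub>M lborel)" .
  qed
  also have "\<dots> = (\<integral>\<^sup>+y. ennreal (h y) * (\<integral>\<^sup>+t. ennreal (norm (y - x) * t powr (- n - 1)) * indicator {norm (y - x)<..<r} t \<partial>lborel) \<partial>lborel)"
    by (intro nn_integral_cong nn_integral_cmult) simp
  also have "\<dots> \<le> (\<integral>\<^sup>+y. ennreal (h y) * (ennreal (norm (y - x) powr (1 - n) / n) * indicator {..<r} (norm (y - x))) \<partial>lborel)"
    by (intro nn_integral_mono mult_left_mono nn_integral_power_Ioo_le n) auto
  also have "\<dots> = (\<integral>\<^sup>+y. ennreal (1 / n) * (ennreal (h y * norm (y - x) powr (1 - n)) * indicator (ball x r) y) \<partial>lborel)"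
    using n unfolding h_def
    by (intro nn_integral_cong) (simp add: indicator_def dist_norm norm_minus_commute flip: ennreal_mult)
  also have "\<dots> = ennreal (1 / n) * (\<integral>\<^sup>+y. ennreal (h y * norm (y - x) powr (1 - n)) * indicator (ball x r) y \<partial>lborel)"
    by (intro nn_integral_cmult borel_measurable_times_ennreal borel_measurable_indicator) auto
  finally have *: "(\<integral>\<^sup>+z. (\<integral>\<^sup>+t. ennreal (h (x + t *\<^sub>R z) * norm z) * indicator {0<..<r} t \<partial>lborel) * indicator (ball 0 1) z \<partial>lborel)
    \<le> ennreal (1 / n) * (\<integral>\<^sup>+y. ennreal (h y * norm (y - x) powr (1 - n)) * indicator (ball x r) y \<partial>lborel)" .
  have "ennreal (unit_ball_vol n * \<bar>u x\<bar>) = ennreal \<bar>u x\<bar> * emeasure lborel (ball (0::'a) 1)"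
    by (simp add: emeasure_ball n_def ennreal_mult mult.commute)
  also have "\<dots> = (\<integral>\<^sup>+z. ennreal \<bar>u x\<bar> * indicator (ball (0::'a) 1) z \<partial>lborel)"
    by (simp add: nn_integral_cmult_indicator)
  also have "\<dots> \<le> (\<integral>\<^sup>+z. ennreal \<bar>u (x + r *\<^sub>R z)\<bar> * indicator (ball 0 1) z +
      (\<integral>\<^sup>+t. ennreal (h (x + t *\<^sub>R z) * norm z) * indicator {0<..<r} t \<partial>lborel) * indicator (ball 0 1) z \<partial>lborel)"
    using ray_bound[OF u r, of x] unfolding h_def
    by (intro nn_integral_mono) (simp split: split_indicator)
  also have "\<dots> = (\<integral>\<^sup>+z. ennreal \<bar>u (x + r *\<^sub>R z)\<bar> * indicator (ball 0 1) z \<partial>lborel) +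
      (\<integral>\<^sup>+z. (\<integral>\<^sup>+t. ennreal (h (x + t *\<^sub>R z) * norm z) * indicator {0<..<r} t \<partial>lborel) * indicator (ball 0 1) z \<partial>lborel)"
  proof (intro nn_integral_add borel_measurable_times_ennreal borel_measurable_indicator)
    show "(\<lambda>z. \<integral>\<^sup>+t. ennreal (h (x + t *\<^sub>R z) * norm z) * indicator {0<..<r} t \<partial>lborel) \<in> borel_measurable lborel"
      by measurable
  qed auto
  also have "\<dots> \<le> (\<integral>\<^sup>+z. ennreal \<bar>u (x + r *\<^sub>R z)\<bar> * indicator (ball 0 1) z \<partial>lborel) +
      ennreal (1 / n) * (\<integral>\<^sup>+y. ennreal (h y * norm (y - x) powr (1 - n)) * indicator (ball x r) y \<partial>lborel)"
    by (intro add_left_mono *)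
  finally show ?thesis unfolding n_def h_def .
qed

section \<open>Growth of the primitive\<close>

lemma powr_le_exp:
  fixes k c :: real
  assumes "k > 0" "c > 0"
  shows "\<exists>C>0. \<forall>s\<ge>1. s powr k \<le> C * exp (c * s)"
proof (intro exI conjI allI impI)
  \<comment> \<open>The maximum of s^k exp(-c s) is (k / (c e))^k; the factor e^-k is
    dropped.\<close>
  show "(k / c) powr k > 0" using assms by simp
  fix s :: real assume s: "s \<ge> 1"
  have "ln (k / c * (c * s / k)) = ln (k / c) + ln (c * s / k)"
    using assms s by (intro ln_mult_pos) auto
  then have "ln s = ln (k / c) + ln (c * s / k)"
    using assms by simp
  also have "ln (c * s / k) \<le> c * s / k"
    using assms s ln_le_minus_one[of "c * s / k"] by simp
  finally have "k * ln s \<le> k * ln (k / c) + c * s"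
    using assms by (simp add: field_simps)
  then have "exp (k * ln s) \<le> exp (k * ln (k / c)) * exp (c * s)"
    by (simp flip: exp_add)
  then show "s powr k \<le> (k / c) powr k * exp (c * s)"
    using assms s by (simp add: powr_def)
qed

context
  fixes N :: nat and a q :: real and f F :: "real \<Rightarrow> real"
  assumes f: "cond_f1 N a q f" and F: "\<And>s. F s = (LBINT \<tau>=0..s. f \<tau>)"
begin

lemma primitive_DERIV: "(F has_real_derivative f x) (at x)"
proof -
  \<comment> \<open>This interval contains the base point 0 of the integral and has \<open>x\<close>
    in its interior, whatever the sign of \<open>x\<close>.\<close>
  have cont: "continuous_on {-\<bar>x\<bar> - 1..\<bar>x\<bar> + 1} f"
    using f unfolding cond_f1_def by (meson continuous_on_subset subset_UNIV)
  have "((\<lambda>u. LBINT y=ereal 0..ereal u. f y) has_vector_derivative f x) (at x within {-\<bar>x\<bar> - 1..\<bar>x\<bar> + 1})"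
    by (rule interval_integral_FTC2[OF _ _ cont]) auto
  moreover have "F = (\<lambda>u. LBINT y=ereal 0..ereal u. f y)"
    using F by (auto simp: zero_ereal_def)
  ultimately have "(F has_vector_derivative f x) (at x within {-\<bar>x\<bar> - 1..\<bar>x\<bar> + 1})"
    by simp
  then have "(F has_vector_derivative f x) (at x)"
    by (subst (asm) at_within_interior) auto
  then show ?thesis by (simp add: has_real_derivative_iff_has_vector_derivative)
qed

lemma primitive_zero: "F 0 = 0"
  unfolding F zero_ereal_def[symmetric] by simp

lemma primitive_mono:
  assumes "x \<le> y" shows "F x \<le> F y"
  using assms
proof (rule DERIV_nonneg_imp_nondecreasing)
  fix x
  have "f x \<ge> 0" using f unfolding cond_f1_def by (cases "x \<ge> 0") auto
  then show "\<exists>y. (F has_real_derivative y) (at x) \<and> 0 \<le> y" using primitive_DERIV by blast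
qed

lemma primitive_continuous: "continuous_on A F"
  by (meson DERIV_continuous_on primitive_DERIV has_field_derivative_at_within)

text \<open>Carries pointwise bounds from \<open>f\<close> to \<open>F\<close> without computing an
  integral, at the cost of one factor \<open>s\<close>.\<close>

lemma primitive_mean_value:
  assumes "s > 0" obtains x where "0 < x" "x < s" "F s = s * f x"
  using MVT2[OF assms, of F f] primitive_DERIV primitive_zero by auto

lemma primitive_le_near_0:
  assumes "q > 1"
  shows "\<exists>C>0. \<forall>s\<in>{0..1}. F s \<le> C * s powr q"
proof -
  have nonneg: "f x \<ge> 0" for x
    using f unfolding cond_f1_def by (cases "x \<ge> 0") auto
  have "f \<in> O[at_right 0](\<lambda>s. s powr (q - 1))"
    using f unfolding cond_f1_def by (intro bigthetaD1) blast
  then obtain c where c: "c > 0" "eventually (\<lambda>s. norm (f s) \<le> c * norm (s powr (q - 1))) (at_right 0)"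
    by (elim landau_o.bigE)
  from c(2) obtain d where d: "d > 0" "\<And>s. 0 < s \<Longrightarrow> s < d \<Longrightarrow> norm (f s) \<le> c * norm (s powr (q - 1))"
    unfolding eventually_at_right_field by blast
  have "compact (f ` {0..1})"
    using f unfolding cond_f1_def
    by (intro compact_continuous_image) (auto intro: continuous_on_subset)
  then have "bounded (f ` {0..1})" by (rule compact_imp_bounded)
  then obtain M where "M > 0" "\<forall>y\<in>f ` {0..1}. norm y \<le> M"
    unfolding bounded_pos by blast
  then have M: "M > 0" "\<And>s. 0 \<le> s \<Longrightarrow> s \<le> 1 \<Longrightarrow> f s \<le> M"
    by (auto simp: abs_le_iff)
  \<comment> \<open>The asymptotic condition controls \<open>f\<close> only below \<open>d\<close>.
    On the rest of the unit interval \<open>f\<close> is at most \<open>M\<close> by compactness,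
    and \<open>s powr (q - 1)\<close> is at least \<open>d powr (q - 1)\<close>.\<close>
  define C where "C = c + M / d powr (q - 1)"
  have C: "C > 0" using c d M by (simp add: C_def add_pos_nonneg)
  have bound: "f s \<le> C * s powr (q - 1)" if s: "0 < s" "s \<le> 1" for s
  proof (cases "s < d")
    case True
    then have "f s \<le> c * s powr (q - 1)" using d(2)[of s] s nonneg[of s] by simp
    also have "\<dots> \<le> C * s powr (q - 1)"
      using M d by (intro mult_right_mono) (auto simp: C_def)
    finally show ?thesis .
  next
    case False
    have "f s \<le> M / d powr (q - 1) * d powr (q - 1)" using M s d by simp
    also have "\<dots> \<le> M / d powr (q - 1) * s powr (q - 1)"
      using False d M assms by (intro mult_left_mono powr_mono2) auto
    also have "\<dots> \<le> C * s powr (q - 1)"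
      using c by (intro mult_right_mono) (auto simp: C_def)
    finally show ?thesis .
  qed
  have "F s \<le> C * s powr q" if s: "s \<in> {0..1}" for s
  proof (cases "s = 0")
    case True
    then show ?thesis by (simp add: primitive_zero)
  next
    case False
    with s have "s > 0" by simp
    then obtain x where x: "0 < x" "x < s" "F s = s * f x" by (rule primitive_mean_value)
    have "f x \<le> C * x powr (q - 1)" using x s by (intro bound) auto
    also have "\<dots> \<le> C * s powr (q - 1)"
      using x C assms by (intro mult_left_mono powr_mono2) auto
    finally have "F s \<le> s * (C * s powr (q - 1))"
      using x \<open>s > 0\<close> by (simp add: mult_left_mono)
    also have "\<dots> = C * s powr q"
      using \<open>s > 0\<close> by (simp add: powr_diff)
    finally show ?thesis .
  qed
  then show ?thesis using C by blast
qed

text \<open>The factor s^p and the extra \<open>s\<close> from the mean value theorem are absorbed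
  by exp((b - a) s). Since the exponent N / (N - 1) is at least 1, this is at most exp((b - a)
  s^(N/(N-1))) for s \<ge> 1, so every \<open>b\<close> above \<open>a\<close> is enough.\<close>

lemma primitive_le_exp:
  assumes "N \<ge> 2" "a \<ge> 0" "b > a"
  shows "\<exists>C>0. \<forall>s\<ge>1. F s \<le> C * exp (b * s powr (real N / (real N - 1)))"
proof -
  define m where "m = real N / (real N - 1)"
  have m: "m \<ge> 1" using assms by (simp add: m_def field_simps)
  obtain C p where C: "C > 0" "p > 0"
    and "\<forall>\<^sub>F s in at_top. f s \<le> C * s powr p * exp (a * s powr m)"
    using f unfolding cond_f1_def m_def by blast
  then obtain K where K: "\<And>s. s \<ge> K \<Longrightarrow> f s \<le> C * s powr p * exp (a * s powr m)"
    unfolding eventually_at_top_linorder by blast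
  have "compact (f ` {0..K})"
    using f unfolding cond_f1_def
    by (intro compact_continuous_image) (auto intro: continuous_on_subset)
  then have "bounded (f ` {0..K})" by (rule compact_imp_bounded)
  then obtain M where "M > 0" "\<forall>y\<in>f ` {0..K}. norm y \<le> M"
    unfolding bounded_pos by blast
  then have M: "M > 0" "\<And>s. 0 \<le> s \<Longrightarrow> s \<le> K \<Longrightarrow> f s \<le> M"
    by (auto simp: abs_le_iff)
  obtain E where E: "E > 0" "\<And>s. s \<ge> 1 \<Longrightarrow> s powr (p + 1) \<le> E * exp ((b - a) * s)"
    using powr_le_exp[of "p + 1" "b - a"] C assms by auto
  have "F s \<le> (M + C) * E * exp (b * s powr m)" if s: "s \<ge> 1" for s
  proof -
    obtain x where x: "0 < x" "x < s" "F s = s * f x"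
      using s by (auto intro: primitive_mean_value[of s])
    have sp: "s powr p \<ge> 1" using s C by (simp add: ge_one_powr_ge_zero)
    have ex: "exp (a * s powr m) \<ge> 1" using assms by simp
    have "f x \<le> (M + C) * (s powr p * exp (a * s powr m))"
    proof (cases "x \<le> K")
      case True
      then have "f x \<le> M * 1" using M x by simp
      also have "\<dots> \<le> (M + C) * (s powr p * exp (a * s powr m))"
        using M C sp ex mult_mono[OF sp ex] by (intro mult_mono) auto
      finally show ?thesis .
    next
      case False
      then have "f x \<le> C * x powr p * exp (a * x powr m)" using K by simp
      also have "\<dots> \<le> C * s powr p * exp (a * s powr m)"
        using x C m assms by (intro mult_mono mult_left_mono powr_mono2) (auto intro!: mult_left_mono powr_mono2)
      also have "\<dots> \<le> (M + C) * (s powr p * exp (a * s powr m))"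
        using M by (simp add: algebra_simps)
      finally show ?thesis .
    qed
    then have "F s \<le> s * ((M + C) * (s powr p * exp (a * s powr m)))"
      using x s by (simp add: mult_left_mono)
    also have "\<dots> = (M + C) * (s powr (p + 1) * exp (a * s powr m))"
      using s by (simp add: powr_add)
    also have "\<dots> \<le> (M + C) * ((E * exp ((b - a) * s)) * exp (a * s powr m))"
      using M C E(2)[OF s] by (intro mult_left_mono mult_right_mono) auto
    also have "\<dots> \<le> (M + C) * ((E * exp ((b - a) * s powr m)) * exp (a * s powr m))"
    proof -
      have "s powr 1 \<le> s powr m" using s m by (intro powr_mono) auto
      then have "exp ((b - a) * s) \<le> exp ((b - a) * s powr m)" using assms s by simp
      then show ?thesis using M C E(1) by (intro mult_left_mono mult_right_mono) auto
    qed
    also have "\<dots> = (M + C) * E * exp (b * s powr m)"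
      by (simp add: algebra_simps flip: exp_add)
    finally show ?thesis .
  qed
  then show ?thesis using M C E(1) unfolding m_def
    by (intro exI[of _ "(M + C) * E"]) auto
qed

end

section \<open>Exponential integrability of the potential\<close>

text \<open>
  Moser--Trudinger below the critical exponent, for the Riesz potential \<open>i\<close> of \<open>h\<close>. Hoelder's
  inequality is applied with the weight \<open>W\<^sup>n\<^sup>-\<^sup>1\<close>, \<open>W = 1 + \<Lambda> \<bar>y - x\<bar>\<^sup>-\<^sup>\<mu>\<close>. It makes the
  dual integral a logarithm in closed form, while \<open>\<Lambda>\<close> is so small that the weight increases
  \<open>\<integral> h\<^sup>n\<close> to at most \<open>A\<close>, which the slack \<open>\<theta> < 1\<close> absorbs.
\<close>

lemma potential_exp_bound:
  assumes dim: "DIM('a::euclidean_space) \<ge> 2" and \<theta>: "0 < \<theta>" "\<theta> < 1"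
  defines "n \<equiv> real DIM('a)"
  defines "\<omega> \<equiv> n * unit_ball_vol n"
  shows "\<exists>\<nu> C. 0 < \<nu> \<and> \<nu> < n \<and> C > 0 \<and>
    (\<forall>h (x::'a) r g. h \<in> borel_measurable borel \<longrightarrow> (\<forall>y. h y \<ge> 0) \<longrightarrow> r > 0 \<longrightarrow> g \<ge> 0 \<longrightarrow>
      (\<integral>\<^sup>+y. ennreal (h y powr n) \<partial>lborel) \<le> 1 \<longrightarrow>
      (\<integral>\<^sup>+y. ennreal (h y powr n * norm (y - x) powr - \<nu>) * indicator (ball x r) y \<partial>lborel) \<le> ennreal g \<longrightarrow>
      (\<exists>i\<ge>0. (\<integral>\<^sup>+y. ennreal (h y * norm (y - x) powr (1 - n)) * indicator (ball x r) y \<partial>lborel) \<le> ennreal i \<and>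
        exp (\<theta> * (n * \<omega> powr (1 / (n - 1))) * (i / \<omega>) powr (n / (n - 1))) \<le> C * (1 + r powr \<nu> * g)))"
proof -
  have n: "n \<ge> 2" using dim by (simp add: n_def)
  have \<omega>: "\<omega> > 0" using n by (simp add: \<omega>_def)
  \<comment> \<open>The midpoint splits the slack between \<theta> and 1: \<kappa> < 1 gives \<nu> <
    n, hence an integrable kernel, and \<kappa> / \<theta> > 1 gives A > 1, the factor by which the
    weight may increase the integral of h^n.\<close>
  define \<kappa> where "\<kappa> = (1 + \<theta>) / 2"
  have \<kappa>: "\<theta> < \<kappa>" "\<kappa> < 1" using \<theta> by (auto simp: \<kappa>_def)
  define \<nu> where "\<nu> = \<kappa> * n"
  \<comment> \<open>Chosen so that the (n-1)-th power of |y - x|^-\<mu> is |y - x|^-\<nu>.\<close>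
  define \<mu> where "\<mu> = \<nu> / (n - 1)"
  have \<nu>: "0 < \<nu>" "\<nu> < n" using \<kappa> \<theta> n by (auto simp: \<nu>_def)
  have \<mu>: "\<mu> > 0" using \<nu> n by (simp add: \<mu>_def)
  define A where "A = (\<kappa> / \<theta>) powr (n - 1)"
  \<comment> \<open>Now (1 + t)^2 = \<kappa> / \<theta>, so the leading coefficient (1 + t)^(n-1)
    stays below \<open>A\<close>; the remainder \<open>D\<close> is the allowance for the singular
    part of the weight.\<close>
  define t where "t = sqrt (\<kappa> / \<theta>) - 1"
  have t: "t > 0" using \<kappa> \<theta> by (simp add: t_def)
  have "1 + t < \<kappa> / \<theta>"
  proof -
    have "1 + t < (1 + t) * (1 + t)" using t by simp
    also have "\<dots> = \<kappa> / \<theta>" using \<kappa> \<theta> by (simp add: t_def)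
    finally show ?thesis .
  qed
  then have tA: "(1 + t) powr (n - 1) < A"
    unfolding A_def using t n by (intro powr_less_mono2) auto
  have A: "A > 0" unfolding A_def using \<kappa> \<theta> by simp
  define D where "D = A - (1 + t) powr (n - 1)"
  have D: "D > 0" using tA by (simp add: D_def)
  define Ct where "Ct = (1 + 1 / t) powr (n - 1)"
  have "1 + 1 / t > 0" using t by (intro add_pos_pos) auto
  then have Ct: "Ct > 0" by (simp add: Ct_def)
  define C where "C = 2 powr (n - 1) * (1 + Ct / D)"
  have C: "C > 0" using Ct D by (simp add: C_def add_pos_pos)
  show ?thesis
  proof (rule exI[of _ \<nu>], rule exI[of _ C], intro conjI allI impI \<nu> C)
    fix h :: "'a \<Rightarrow> real" and x :: 'a and r g :: real
    assume h[measurable]: "h \<in> borel_measurable borel" and h0: "\<forall>y. h y \<ge> 0" and r: "r > 0" and g: "g \<ge> 0"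
      and h1: "(\<integral>\<^sup>+y. ennreal (h y powr n) \<partial>lborel) \<le> 1"
      and hg: "(\<integral>\<^sup>+y. ennreal (h y powr n * norm (y - x) powr - \<nu>) * indicator (ball x r) y \<partial>lborel) \<le> ennreal g"
    define Y where "Y = 1 + r powr \<nu> * g"
    have Y: "Y \<ge> 1" using g by (simp add: Y_def)
    \<comment> \<open>Solved from two demands: the singular part costs Ct \<Lambda>^(n-1) g = D (Y -
      1) / Y, within the allowance \<open>D\<close>, and (r^\<mu> / \<Lambda>)^(n-1) = Ct Y / D is
      affine in \<open>g\<close>, which makes the final bound integrable by Tonelli.\<close>
    define \<Lambda> where "\<Lambda> = (D / (Ct * Y)) powr (1 / (n - 1)) * r powr \<mu>"
    have \<Lambda>: "\<Lambda> > 0" using D Ct Y r by (simp add: \<Lambda>_def)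
    have \<Lambda>n: "\<Lambda> powr (n - 1) = D / (Ct * Y) * r powr \<nu>"
      using D Ct Y r n by (simp add: \<Lambda>_def powr_mult powr_powr \<mu>_def)
    define W where "W = (\<lambda>y. 1 + \<Lambda> * norm (y - x) powr - \<mu>)"
    have W: "W y \<ge> 1" for y using \<Lambda> by (simp add: W_def)
    define J where "J = \<omega> / \<mu> * ln (1 + r powr \<mu> / \<Lambda>)"
    have rL: "r powr \<mu> / \<Lambda> > 0" using r \<Lambda> by simp
    then have J: "J > 0" using \<omega> \<mu> unfolding J_def by (intro mult_pos_pos ln_gt_zero divide_pos_pos) auto
    \<comment> \<open>The weight cancels in the product with \<open>f2\<close>. On the ball, f1^n =
      h^n W^(n-1), and the conjugate power of \<open>f2\<close> is |y - x|^-n / W, the kernel of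
      \<open>nn_integral_log_kernel\<close>.\<close>
    define f1 where "f1 = (\<lambda>y. h y * W y powr ((n - 1) / n) * indicator (ball x r) y)"
    define f2 where "f2 = (\<lambda>y. norm (y - x) powr (1 - n) * W y powr - ((n - 1) / n) * indicator (ball x r) y)"
    have [measurable]: "W \<in> borel_measurable borel" unfolding W_def by measurable
    have f1m: "f1 \<in> borel_measurable lborel" "f2 \<in> borel_measurable lborel"
      unfolding f1_def f2_def
      by (auto intro!: borel_measurable_times powr_real_measurable borel_measurable_indicator borel_measurable_norm)
    have H1: "(\<integral>\<^sup>+y. ennreal (f1 y powr n) \<partial>lborel) \<le> ennreal A"
    proof -
      have f1_le: "f1 y powr n \<le> (1 + t) powr (n - 1) * h y powr n + Ct * \<Lambda> powr (n - 1) * (h y powr n * norm (y - x) powr - \<nu> * indicator (ball x r) y)" for y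
      proof (cases "y \<in> ball x r")
        case True
        have "f1 y powr n = h y powr n * W y powr (n - 1)"
          using True h0 W[of y] n by (simp add: f1_def powr_mult powr_powr)
        also have "\<dots> \<le> h y powr n * ((1 + t) powr (n - 1) * 1 powr (n - 1) + Ct * (\<Lambda> * norm (y - x) powr - \<mu>) powr (n - 1))"
          unfolding W_def Ct_def using \<Lambda> t n by (intro mult_left_mono powr_add_le) auto
        also have "(\<Lambda> * norm (y - x) powr - \<mu>) powr (n - 1) = \<Lambda> powr (n - 1) * norm (y - x) powr - \<nu>"
          using \<Lambda> n by (simp add: powr_mult powr_powr \<mu>_def)
        finally show ?thesis using True by (simp add: algebra_simps)
      next
        case False
        then show ?thesis using n by (simp add: f1_def)
      qed
      define k1 where "k1 = (\<lambda>y. ennreal (h y powr n))"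
      define k2 where "k2 = (\<lambda>y. ennreal (h y powr n * norm (y - x) powr - \<nu>) * indicator (ball x r) y)"
      have [measurable]: "k1 \<in> borel_measurable lborel" "k2 \<in> borel_measurable lborel"
        unfolding k1_def k2_def
        by (auto intro!: borel_measurable_times_ennreal borel_measurable_indicator)
      have "(\<integral>\<^sup>+y. ennreal (f1 y powr n) \<partial>lborel) \<le>
        (\<integral>\<^sup>+y. ennreal ((1 + t) powr (n - 1)) * k1 y + ennreal (Ct * \<Lambda> powr (n - 1)) * k2 y \<partial>lborel)"
      proof (rule nn_integral_mono)
        fix y
        have k2: "k2 y = ennreal (h y powr n * norm (y - x) powr - \<nu> * indicator (ball x r) y)"
          unfolding k2_def by (cases "y \<in> ball x r") auto
        have "ennreal (f1 y powr n) \<le> ennreal ((1 + t) powr (n - 1) * h y powr n + Ct * \<Lambda> powr (n - 1) * (h y powr n * norm (y - x) powr - \<nu> * indicator (ball x r) y))"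
          by (intro ennreal_leI f1_le)
        also have "\<dots> = ennreal ((1 + t) powr (n - 1) * h y powr n) + ennreal (Ct * \<Lambda> powr (n - 1) * (h y powr n * norm (y - x) powr - \<nu> * indicator (ball x r) y))"
          using Ct by (intro ennreal_plus) auto
        also have "\<dots> = ennreal ((1 + t) powr (n - 1)) * k1 y + ennreal (Ct * \<Lambda> powr (n - 1)) * k2 y"
          unfolding k2 k1_def using Ct by (intro arg_cong2[of _ _ _ _ "(+)"] ennreal_mult') auto
        finally show "ennreal (f1 y powr n) \<le> \<dots>" .
      qed
      also have "\<dots> = ennreal ((1 + t) powr (n - 1)) * (\<integral>\<^sup>+y. k1 y \<partial>lborel) + ennreal (Ct * \<Lambda> powr (n - 1)) * (\<integral>\<^sup>+y. k2 y \<partial>lborel)"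
        by (simp add: nn_integral_add nn_integral_cmult)
      also have "\<dots> \<le> ennreal ((1 + t) powr (n - 1)) * ennreal 1 + ennreal (Ct * \<Lambda> powr (n - 1)) * ennreal g"
        using h1 hg unfolding k1_def k2_def by (intro add_mono mult_left_mono) auto
      also have "\<dots> = ennreal ((1 + t) powr (n - 1) + Ct * \<Lambda> powr (n - 1) * g)"
        using g Ct by (simp flip: ennreal_mult ennreal_plus)
      also have "\<dots> \<le> ennreal A"
      proof (rule ennreal_leI)
        have "Ct * \<Lambda> powr (n - 1) * g = D * ((Y - 1) / Y)"
          using Ct Y by (simp add: \<Lambda>n Y_def)
        also have "\<dots> \<le> D * 1" using D Y by (intro mult_left_mono) auto
        finally show "(1 + t) powr (n - 1) + Ct * \<Lambda> powr (n - 1) * g \<le> A" by (simp add: D_def)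
      qed
      finally show ?thesis .
    qed
    have H2: "(\<integral>\<^sup>+y. ennreal (f2 y powr (n / (n - 1))) \<partial>lborel) \<le> ennreal J"
    proof -
      have "f2 y powr (n / (n - 1)) = norm (y - x) powr - n / W y * indicator (ball x r) y" for y
      proof (cases "y \<in> ball x r")
        case True
        have "(1 - n) * (n / (n - 1)) = - n" using n by (simp add: field_simps)
        moreover have "- ((n - 1) / n) * (n / (n - 1)) = -1" using n by (simp add: field_simps)
        moreover have "f2 y powr (n / (n - 1)) =
            norm (y - x) powr ((1 - n) * (n / (n - 1))) * W y powr (- ((n - 1) / n) * (n / (n - 1)))"
          using True by (simp add: f2_def powr_mult powr_powr del: minus_divide_left minus_mult_left minus_mult_minus times_divide_eq_left times_divide_eq_right mult_minus_left)
        ultimately show ?thesis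
          using True W[of y] by (simp only:) (simp add: powr_minus_divide)
      qed (simp add: f2_def)
      then have "(\<integral>\<^sup>+y. ennreal (f2 y powr (n / (n - 1))) \<partial>lborel) =
        (\<integral>\<^sup>+y. ennreal (norm (y - x) powr - n / (1 + \<Lambda> * norm (y - x) powr - \<mu>)) * indicator (ball x r) y \<partial>lborel)"
        unfolding W_def by (intro nn_integral_cong) (simp split: split_indicator)
      also have "\<dots> = ennreal J"
        unfolding n_def J_def \<omega>_def using r \<mu> \<Lambda> by (intro nn_integral_log_kernel) auto
      finally show ?thesis by simp
    qed
    define i where "i = A powr (1 / n) * J powr (1 / (n / (n - 1)))"
    have i: "i \<ge> 0" by (simp add: i_def)
    have "(\<integral>\<^sup>+y. ennreal (f1 y * f2 y) \<partial>lborel) \<le> ennreal i"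
      unfolding i_def
    proof (rule nn_integral_Holder[OF _ _ _ f1m _ _ A J H1 H2])
      show "n > 1" "n / (n - 1) > 1" "1 / n + 1 / (n / (n - 1)) = 1"
        using n by (auto simp: field_simps)
      show "f1 y \<ge> 0" "f2 y \<ge> 0" for y using h0 by (auto simp: f1_def f2_def)
    qed
    also have "(\<lambda>y. ennreal (f1 y * f2 y)) = (\<lambda>y. ennreal (h y * norm (y - x) powr (1 - n)) * indicator (ball x r) y)"
    proof
      fix y
      have "W y powr ((n - 1) / n) * W y powr - ((n - 1) / n) = 1"
        using W[of y] by (simp flip: powr_add)
      then have "h y * W y powr ((n - 1) / n) * (norm (y - x) powr (1 - n) * W y powr - ((n - 1) / n)) = h y * norm (y - x) powr (1 - n)"
        by (metis (no_types, opaque_lifting) mult.assoc mult.commute mult.right_neutral)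
      then show "ennreal (f1 y * f2 y) = ennreal (h y * norm (y - x) powr (1 - n)) * indicator (ball x r) y"
        unfolding f1_def f2_def by (cases "y \<in> ball x r") (simp_all only: indicator_simps not_False_eq_True mult_1_right mult_zero_right ennreal_0)
    qed
    finally have i_bound: "(\<integral>\<^sup>+y. ennreal (h y * norm (y - x) powr (1 - n)) * indicator (ball x r) y \<partial>lborel) \<le> ennreal i" .
    have "(i / \<omega>) powr (n / (n - 1)) = A powr (1 / (n - 1)) * J / \<omega> powr (n / (n - 1))"
      using i \<omega> A J n by (simp add: powr_divide i_def powr_mult powr_powr)
    also have "A powr (1 / (n - 1)) = \<kappa> / \<theta>"
      using n \<kappa> \<theta> by (simp add: A_def powr_powr)
    also have "\<omega> powr (n / (n - 1)) = \<omega> * \<omega> powr (1 / (n - 1))"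
    proof -
      have "n / (n - 1) = 1 + 1 / (n - 1)" using n by (simp add: field_simps)
      then show ?thesis using \<omega> by (simp add: powr_add)
    qed
    finally have "\<theta> * (n * \<omega> powr (1 / (n - 1))) * (i / \<omega>) powr (n / (n - 1)) = n * \<kappa> * J / \<omega>"
      using \<theta> \<omega> by simp
    \<comment> \<open>The powers of \<omega> have cancelled against the critical constant, and n
      \<kappa> = (n - 1) \<mu> makes the coefficient of the logarithm exactly n - 1, so its
      exponential is the power needed above.\<close>
    also have "\<dots> = (n - 1) * ln (1 + r powr \<mu> / \<Lambda>)"
    proof -
      have "n * \<kappa> = (n - 1) * \<mu>" using n by (simp add: \<mu>_def \<nu>_def)
      then show ?thesis using \<omega> \<mu> by (simp add: J_def)
    qed
    finally have "exp (\<theta> * (n * \<omega> powr (1 / (n - 1))) * (i / \<omega>) powr (n / (n - 1))) = (1 + r powr \<mu> / \<Lambda>) powr (n - 1)"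
      using rL by (simp only: powr_def) simp
    also have "\<dots> \<le> (1 + 1) powr (n - 1) * 1 powr (n - 1) + (1 + 1 / 1) powr (n - 1) * (r powr \<mu> / \<Lambda>) powr (n - 1)"
      using \<Lambda> n by (intro powr_add_le) auto
    also have "(r powr \<mu> / \<Lambda>) powr (n - 1) = Ct * Y / D"
    proof -
      have "(r powr \<mu> / \<Lambda>) powr (n - 1) = r powr \<nu> / (D / (Ct * Y) * r powr \<nu>)"
        using \<Lambda> n r by (simp add: powr_divide powr_powr \<mu>_def \<Lambda>n)
      then show ?thesis using r D by simp
    qed
    also have "(1 + 1) powr (n - 1) * 1 powr (n - 1) + (1 + 1 / 1) powr (n - 1) * (Ct * Y / D) \<le> C * Y"
      using Y Ct D by (simp add: C_def algebra_simps)
    finally show "\<exists>i\<ge>0. (\<integral>\<^sup>+y. ennreal (h y * norm (y - x) powr (1 - n)) * indicator (ball x r) y \<partial>lborel) \<le> ennreal i \<and>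
        exp (\<theta> * (n * \<omega> powr (1 / (n - 1))) * (i / \<omega>) powr (n / (n - 1))) \<le> C * (1 + r powr \<nu> * g)"
      using i i_bound unfolding Y_def by blast
  qed
qed

text \<open>The cone over the sphere is the closed ball without its centre, since \<open>r\<close>
  is positive there; the centre is a null set.\<close>

lemma sphere_measure_unit_sphere:
  "sphere_measure (sphere (0::'a::euclidean_space) 1) = real DIM('a) * unit_ball_vol (real DIM('a))"
proof -
  have "{r *\<^sub>R x | r x. 0 < r \<and> r \<le> 1 \<and> x \<in> sphere (0::'a) 1} = cball 0 1 - {0}"
  proof (intro equalityI subsetI)
    fix y :: 'a assume "y \<in> cball 0 1 - {0}"
    then have "y = norm y *\<^sub>R (y /\<^sub>R norm y)" "0 < norm y" "norm y \<le> 1" "y /\<^sub>R norm y \<in> sphere 0 1"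
      by auto
    then show "y \<in> {r *\<^sub>R x | r x. 0 < r \<and> r \<le> 1 \<and> x \<in> sphere (0::'a) 1}" by blast
  qed auto
  moreover have "measure lebesgue (cball (0::'a) 1 - {0}) = measure lebesgue (cball (0::'a) 1)"
    by (rule measure_Diff_null_set) (auto simp flip: negligible_iff_null_sets)
  ultimately show ?thesis
    unfolding sphere_measure_def by (simp add: content_cball)
qed

lemma critical_alpha_eq:
  "critical_alpha TYPE('a::euclidean_space) =
    real DIM('a) * (real DIM('a) * unit_ball_vol (real DIM('a))) powr (1 / (real DIM('a) - 1))"
  unfolding critical_alpha_def sphere_measure_unit_sphere ..

section \<open>The logarithmic weight\<close>

definition log_weight :: "'a::euclidean_space \<Rightarrow> real" where
  "log_weight x = ln (exp 1 + norm x)"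

text \<open>
  The scale at which a ball around \<open>x\<close> has volume comparable to \<open>1 / log_weight x\<close>: the weight is
  nearly constant on it, so the mean of \<open>\<bar>u\<bar>\<^sup>q\<close> is bounded by the weighted integral.
\<close>

definition log_radius :: "'a::euclidean_space \<Rightarrow> real" where
  "log_radius x = log_weight x powr (- 1 / DIM('a))"

lemma log_weight_ge_1: "log_weight x \<ge> 1"
proof -
  have "ln (exp 1) \<le> ln (exp 1 + norm x)"
    by (subst ln_le_cancel_iff) (auto simp: add_pos_nonneg)
  then show ?thesis by (simp add: log_weight_def)
qed

text \<open>Moving by at most 1 multiplies e + |y| by at most e, so the logarithm grows by at most
  1; this is at most a doubling because the weight is at least 1.\<close>

lemma log_weight_le_double:
  assumes "dist x y \<le> 1" shows "log_weight x \<le> 2 * log_weight y"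
proof -
  have xy: "norm x \<le> norm y + 1" using assms by norm
  have e: "exp (1::real) \<ge> 2" using exp_ge_add_one_self[of 1] by simp
  have "exp 1 + norm x \<le> 2 * (exp 1 + norm y)"
    using xy e norm_ge_zero[of y] unfolding distrib_left by linarith
  also have "\<dots> \<le> exp 1 * (exp 1 + norm y)"
    using e by (intro mult_right_mono add_nonneg_nonneg) auto
  finally have "exp 1 + norm x \<le> exp 1 * (exp 1 + norm y)" .
  then have "ln (exp 1 + norm x) \<le> ln (exp 1 * (exp 1 + norm y))"
    by (subst ln_le_cancel_iff) (auto simp: add_pos_nonneg)
  also have "\<dots> = 1 + ln (exp 1 + norm y)"
    by (subst ln_mult_pos) (auto simp: add_pos_nonneg)
  finally show ?thesis using log_weight_ge_1[of y] by (simp add: log_weight_def)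
qed

lemma log_radius_pos: "log_radius x > 0"
  using log_weight_ge_1[of x] by (simp add: log_radius_def)

lemma log_radius_le_1: "log_radius x \<le> 1"
  using log_weight_ge_1[of x] powr_mono[of "- 1 / DIM('a)" 0 "log_weight x"]
  by (simp add: log_radius_def)

lemma log_weight_measurable [measurable]: "log_weight \<in> borel_measurable borel"
  unfolding log_weight_def by measurable

lemma log_radius_measurable [measurable]: "log_radius \<in> borel_measurable borel"
  unfolding log_radius_def by measurable

lemma nn_integral_log_measure:
  assumes "f \<in> borel_measurable lebesgue"
  shows "(\<integral>\<^sup>+x. f x \<partial>log_measure) = (\<integral>\<^sup>+x. ennreal (log_weight x) * f x \<partial>lebesgue)"
proof -
  note assms[measurable]
  have [measurable]: "log_weight \<in> borel_measurable lebesgue"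
    by (simp add: measurable_completion)
  show ?thesis
    unfolding log_measure_def log_weight_def[symmetric]
    by (intro nn_integral_density) measurable
qed

text \<open>From |s| \<le> 1 + |s|^q: the first summand gives the volume of the unit ball. In the
  second, rescaling to the ball around \<open>x\<close> produces r^-N, which is exactly
  \<open>log_weight x\<close>; replacing it by the weight at the integration point costs the factor
  2.\<close>

lemma average_bound:
  fixes u :: "'a::euclidean_space \<Rightarrow> real"
  assumes [measurable]: "u \<in> borel_measurable borel" and q: "q \<ge> 1"
    and u: "(\<integral>\<^sup>+y. ennreal (\<bar>u y\<bar> powr q) \<partial>log_measure) \<le> 1"
  shows "(\<integral>\<^sup>+z. ennreal \<bar>u (x + log_radius x *\<^sub>R z)\<bar> * indicator (ball 0 1) z \<partial>lborel)
    \<le> ennreal (unit_ball_vol (real DIM('a)) + 2)"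
proof -
  let ?r = "log_radius x"
  note r = log_radius_pos[of x] log_radius_le_1[of x]
  have w: "log_weight x \<ge> 1" by (rule log_weight_ge_1)
  define k where "k = (\<lambda>y. ennreal (\<bar>u y\<bar> powr q) * indicator (ball x ?r) y)"
  have [measurable]: "k \<in> borel_measurable borel"
    unfolding k_def by (intro borel_measurable_times_ennreal borel_measurable_indicator) auto
  have "\<bar>s\<bar> \<le> 1 + \<bar>s\<bar> powr q" for s :: real
  proof (cases "\<bar>s\<bar> \<le> 1")
    case True
    then show ?thesis using powr_ge_zero[of "\<bar>s\<bar>" q] by linarith
  next
    case False
    then have "\<bar>s\<bar> powr 1 \<le> \<bar>s\<bar> powr q" using q by (intro powr_mono) auto
    then show ?thesis using False by simp
  qed
  then have abs_le: "ennreal \<bar>s\<bar> \<le> 1 + ennreal (\<bar>s\<bar> powr q)" for s :: real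
    using ennreal_leI[of "\<bar>s\<bar>" "1 + \<bar>s\<bar> powr q"] by simp
  have "(\<integral>\<^sup>+z. ennreal \<bar>u (x + ?r *\<^sub>R z)\<bar> * indicator (ball 0 1) z \<partial>lborel) \<le>
      (\<integral>\<^sup>+z. indicator (ball 0 1) z + k (x + ?r *\<^sub>R z) \<partial>lborel)"
    using r abs_le unfolding k_def
    by (intro nn_integral_mono) (simp add: dist_norm indicator_def)
  also have "\<dots> = (\<integral>\<^sup>+z. indicator (ball (0::'a) 1) z \<partial>lborel) + (\<integral>\<^sup>+z. k (x + ?r *\<^sub>R z) \<partial>lborel)"
    by (intro nn_integral_add borel_measurable_indicator) auto
  also have "(\<integral>\<^sup>+z. indicator (ball (0::'a) 1) z \<partial>lborel) = ennreal (unit_ball_vol (real DIM('a)))"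
    by (simp add: emeasure_ball)
  also have "(\<integral>\<^sup>+z. k (x + ?r *\<^sub>R z) \<partial>lborel) = ennreal (log_weight x) * (\<integral>\<^sup>+y. k y \<partial>lborel)"
    using w r by (subst nn_integral_affine) (auto simp: log_radius_def powr_powr)
  also have "\<dots> = (\<integral>\<^sup>+y. ennreal (log_weight x) * k y \<partial>lborel)"
    by (intro nn_integral_cmult[symmetric]) auto
  also have "\<dots> \<le> (\<integral>\<^sup>+y. 2 * (ennreal (log_weight y) * ennreal (\<bar>u y\<bar> powr q)) \<partial>lborel)"
  proof (rule nn_integral_mono)
    fix y
    show "ennreal (log_weight x) * k y \<le> 2 * (ennreal (log_weight y) * ennreal (\<bar>u y\<bar> powr q))"
    proof (cases "y \<in> ball x ?r")
      case True
      then have "log_weight x \<le> 2 * log_weight y"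
        using r by (intro log_weight_le_double) auto
      then have "ennreal (log_weight x) \<le> ennreal (2 * log_weight y)"
        by (rule ennreal_leI)
      also have "\<dots> = 2 * ennreal (log_weight y)"
        by (subst ennreal_mult') simp_all
      finally have "ennreal (log_weight x) * ennreal (\<bar>u y\<bar> powr q) \<le> 2 * ennreal (log_weight y) * ennreal (\<bar>u y\<bar> powr q)"
        by (rule mult_right_mono) simp
      then show ?thesis using True by (simp add: k_def mult.assoc)
    qed (simp add: k_def)
  qed
  also have "\<dots> = 2 * (\<integral>\<^sup>+y. ennreal (log_weight y) * ennreal (\<bar>u y\<bar> powr q) \<partial>lborel)"
    by (intro nn_integral_cmult) auto
  also have "\<dots> = 2 * (\<integral>\<^sup>+y. ennreal (\<bar>u y\<bar> powr q) \<partial>log_measure)"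
    by (subst nn_integral_log_measure) (auto simp: nn_integral_completion intro!: measurable_completion)
  also have "\<dots> \<le> 2 * 1"
    using u by (intro mult_left_mono) auto
  finally have "(\<integral>\<^sup>+z. ennreal \<bar>u (x + ?r *\<^sub>R z)\<bar> * indicator (ball 0 1) z \<partial>lborel)
      \<le> ennreal (unit_ball_vol (real DIM('a))) + 2 * 1"
    by (simp only: add_left_mono)
  then show ?thesis by simp
qed

section \<open>Exponential and uniform estimates for test functions against the weight\<close>

lemma test_function_exp_bound:
  fixes \<alpha> q :: real
  assumes dim: "DIM('a::euclidean_space) \<ge> 2" and q: "q \<ge> 1" and \<alpha>: "0 < \<alpha>" "\<alpha> < 1"
  defines "n \<equiv> real DIM('a)"
  shows "\<exists>b \<nu> C. b > critical_alpha TYPE('a) \<and> 0 < \<nu> \<and> \<nu> < n \<and> C > 0 \<and>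
    (\<forall>u (x::'a). test_function u \<longrightarrow> (\<integral>\<^sup>+y. ennreal (\<bar>u y\<bar> powr q) \<partial>log_measure) \<le> 1 \<longrightarrow>
      (\<integral>\<^sup>+y. ennreal (norm (grad u y) powr n) \<partial>lborel) \<le> 1 \<longrightarrow>
      ennreal (exp (b * (\<alpha> * \<bar>u x\<bar>) powr (n / (n - 1)))) \<le> ennreal C * (1 + ennreal (log_radius x powr \<nu>) *
        (\<integral>\<^sup>+y. ennreal (norm (grad u y) powr n * norm (y - x) powr - \<nu>) * indicator (ball x (log_radius x)) y \<partial>lborel)))"
proof -
  have n: "n \<ge> 2" using dim by (simp add: n_def)
  define V where "V = unit_ball_vol n"
  have V: "V > 0" using n by (simp add: V_def)
  define a where "a = n * (n * V) powr (1 / (n - 1))"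
  have a: "a > 0" "critical_alpha TYPE('a) = a"
    using n V by (simp add: a_def) (simp add: a_def critical_alpha_eq n_def V_def)
  define m where "m = n / (n - 1)"
  have m: "m > 0" using n by (simp add: m_def)
  \<comment> \<open>The gap between \<alpha> and 1 is divided into three equal factors: one raises
    the exponent from the critical value to \<open>b\<close>, one separates the bounded mean from
    the potential, and one leaves \<theta> < 1 for the potential.\<close>
  define \<sigma> where "\<sigma> = \<alpha> powr (- 1 / 3)"
  have \<sigma>: "\<sigma> > 1"
    unfolding \<sigma>_def using \<alpha> powr_less_mono2_neg[of "- 1 / 3" \<alpha> 1] by simp
  have \<sigma>\<alpha>: "\<sigma> powr 3 * \<alpha> = 1"
  proof -
    have "\<sigma> powr 3 = \<alpha> powr - 1" unfolding \<sigma>_def powr_powr by simp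
    then show ?thesis using \<alpha> by (simp add: powr_minus)
  qed
  define \<theta> where "\<theta> = \<sigma> powr - m"
  have \<theta>: "0 < \<theta>" "\<theta> < 1"
    using \<sigma> m by (auto simp: \<theta>_def powr_less_one)
  define b where "b = a * \<sigma> powr m"
  have b: "b > a" using a \<sigma> m by (simp add: b_def)
  have \<theta>_eq: "b * (\<sigma> * \<alpha>) powr m = \<theta> * a"
  proof -
    have "\<sigma> * (\<sigma> * \<alpha>) = 1 / \<sigma>"
      using \<sigma> \<sigma>\<alpha> by (simp add: field_simps power3_eq_cube)
    then have "\<sigma> powr m * (\<sigma> * \<alpha>) powr m = (1 / \<sigma>) powr m"
      using \<sigma> \<alpha> by (simp flip: powr_mult)
    also have "\<dots> = \<theta>" using \<sigma> by (simp add: \<theta>_def powr_divide powr_minus_divide)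
    finally show ?thesis by (simp add: b_def mult.assoc)
  qed
  obtain \<nu> C where \<nu>: "0 < \<nu>" "\<nu> < n" and C: "C > 0" and pot:
    "\<And>h (x::'a) r g. h \<in> borel_measurable borel \<Longrightarrow> (\<And>y. h y \<ge> 0) \<Longrightarrow> r > 0 \<Longrightarrow> g \<ge> 0 \<Longrightarrow>
      (\<integral>\<^sup>+y. ennreal (h y powr n) \<partial>lborel) \<le> 1 \<Longrightarrow>
      (\<integral>\<^sup>+y. ennreal (h y powr n * norm (y - x) powr - \<nu>) * indicator (ball x r) y \<partial>lborel) \<le> ennreal g \<Longrightarrow>
      (\<exists>i\<ge>0. (\<integral>\<^sup>+y. ennreal (h y * norm (y - x) powr (1 - n)) * indicator (ball x r) y \<partial>lborel) \<le> ennreal i \<and>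
        exp (\<theta> * a * (i / (n * V)) powr m) \<le> C * (1 + r powr \<nu> * g))"
    using potential_exp_bound[where 'a = 'a, OF dim \<theta>] unfolding n_def[symmetric] V_def[symmetric] a_def m_def by blast
  \<comment> \<open>The bound of \<open>average_bound\<close> divided by the volume on the left of
    \<open>riesz_bound\<close>; \<open>B\<close> is the constant factor it contributes to the
    exponential.\<close>
  define A where "A = (V + 2) / V"
  have A: "A > 0" using V by (simp add: A_def)
  define B where "B = exp (b * \<alpha> powr m * ((1 + 1 / (\<sigma> - 1)) powr m * A powr m))"
  show ?thesis
  proof (rule exI[of _ b], rule exI[of _ \<nu>], rule exI[of _ "B * C"], intro conjI allI impI)
    show "b > critical_alpha TYPE('a)" using a b by simp
    show "B * C > 0" using C by (simp add: B_def)
    show "0 < \<nu>" "\<nu> < n" by fact+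
    fix u :: "'a \<Rightarrow> real" and x :: 'a
    assume u: "test_function u" and u1: "(\<integral>\<^sup>+y. ennreal (\<bar>u y\<bar> powr q) \<partial>log_measure) \<le> 1"
      and u2: "(\<integral>\<^sup>+y. ennreal (norm (grad u y) powr n) \<partial>lborel) \<le> 1"
    let ?r = "log_radius x"
    let ?G = "\<integral>\<^sup>+y. ennreal (norm (grad u y) powr n * norm (y - x) powr - \<nu>) * indicator (ball x ?r) y \<partial>lborel"
    have um: "u \<in> borel_measurable borel" "(\<lambda>y. norm (grad u y)) \<in> borel_measurable borel"
      using test_function_continuous[OF u] test_function_grad_continuous[OF u]
      by (auto intro!: borel_measurable_continuous_onI continuous_intros)
    show "ennreal (exp (b * (\<alpha> * \<bar>u x\<bar>) powr (n / (n - 1)))) \<le> ennreal (B * C) * (1 + ennreal (?r powr \<nu>) * ?G)"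
    proof (cases "?G = \<infinity>")
      case True
      then show ?thesis
        using log_radius_pos[of x] C by (simp add: ennreal_mult_top B_def)
    next
      case False
      then obtain g where g: "g \<ge> 0" "?G = ennreal g" by (cases ?G) auto
      obtain i where i: "i \<ge> 0"
        "(\<integral>\<^sup>+y. ennreal (norm (grad u y) * norm (y - x) powr (1 - n)) * indicator (ball x ?r) y \<partial>lborel) \<le> ennreal i"
        "exp (\<theta> * a * (i / (n * V)) powr m) \<le> C * (1 + ?r powr \<nu> * g)"
        using pot[OF um(2) norm_ge_zero log_radius_pos[of x] g(1) u2 eq_refl[OF g(2)]] by blast
      have "ennreal (V * \<bar>u x\<bar>) \<le> ennreal (V + 2) + ennreal (1 / n) * ennreal i"
        unfolding V_def n_def
        by (rule order.trans[OF riesz_bound[OF u log_radius_pos[of x], of x]])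
           (intro add_mono mult_left_mono average_bound[OF um(1) q u1] i(2)[unfolded n_def] zero_le)
      also have "\<dots> = ennreal (V + 2 + i / n)"
        using V i n by (simp flip: ennreal_mult ennreal_plus)
      finally have "V * \<bar>u x\<bar> \<le> V + 2 + i / n"
        using V i n by (subst (asm) ennreal_le_iff) auto
      then have "\<bar>u x\<bar> \<le> i / (n * V) + A"
        using V n by (simp add: A_def field_simps)
      then have "\<bar>u x\<bar> powr m \<le> (i / (n * V) + A) powr m"
        using m by (intro powr_mono2) auto
      also have "\<dots> \<le> (1 + (\<sigma> - 1)) powr m * (i / (n * V)) powr m + (1 + 1 / (\<sigma> - 1)) powr m * A powr m"
        using i n V A \<sigma> m by (intro powr_add_le) auto
      finally have "b * \<alpha> powr m * \<bar>u x\<bar> powr m \<le>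
          b * \<alpha> powr m * (\<sigma> powr m * (i / (n * V)) powr m + (1 + 1 / (\<sigma> - 1)) powr m * A powr m)"
        using a b by (intro mult_left_mono) auto
      also have "\<dots> = b * (\<sigma> * \<alpha>) powr m * (i / (n * V)) powr m + b * \<alpha> powr m * ((1 + 1 / (\<sigma> - 1)) powr m * A powr m)"
        using \<alpha> \<sigma> by (simp add: powr_mult algebra_simps)
      finally have "exp (b * (\<alpha> * \<bar>u x\<bar>) powr m) \<le> B * exp (\<theta> * a * (i / (n * V)) powr m)"
        using \<alpha> unfolding \<theta>_eq B_def by (simp add: powr_mult mult.assoc add.commute flip: exp_add)
      also have "\<dots> \<le> B * (C * (1 + ?r powr \<nu> * g))"
        using i by (intro mult_left_mono) (auto simp: B_def)
      finally have "ennreal (exp (b * (\<alpha> * \<bar>u x\<bar>) powr m)) \<le> ennreal (B * C * (1 + ?r powr \<nu> * g))"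
        by (intro ennreal_leI) (simp add: mult.assoc)
      also have "\<dots> = ennreal (B * C) * (1 + ennreal (?r powr \<nu>) * ennreal g)"
        using g C by (simp add: ennreal_mult B_def)
      finally show ?thesis unfolding m_def g(2) .
    qed
  qed
qed

text \<open>After exchanging the integrals, \<open>x\<close> runs over points near a fixed
  \<open>y\<close>. Doubling replaces weight and radius at \<open>x\<close> by those at
  \<open>y\<close>, and the powers of \<open>log_weight y\<close> cancel, leaving a
  constant.\<close>

lemma weighted_potential_integral:
  fixes h :: "'a::euclidean_space \<Rightarrow> real"
  defines "n \<equiv> real DIM('a)"
  assumes [measurable]: "h \<in> borel_measurable borel" and h: "\<And>y. h y \<ge> 0" and \<nu>: "0 < \<nu>" "\<nu> < n"
  shows "(\<integral>\<^sup>+x. ennreal (log_weight x) * (ennreal (log_radius x powr \<nu>) *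
      (\<integral>\<^sup>+y. ennreal (h y * norm (y - x) powr - \<nu>) * indicator (ball x (log_radius x)) y \<partial>lborel)) \<partial>lborel)
    \<le> ennreal (4 powr (1 - \<nu> / n) * (n * unit_ball_vol n / (n - \<nu>))) * (\<integral>\<^sup>+y. ennreal (h y) \<partial>lborel)"
proof -
  have n: "n > 0" by (simp add: n_def)
  define e where "e = 1 - \<nu> / n"
  have e: "e > 0" using \<nu> n by (simp add: e_def)
  define k where "k = (\<lambda>x y. ennreal (h y) * (ennreal (log_weight x powr e * norm (y - x) powr - \<nu>) * indicator {x. dist x y < log_radius x} x))"
  have k_meas: "(\<lambda>(x, y). k x y) \<in> borel_measurable (lborel \<Otimes>\<^sub>M lborel)"
  proof -
    have "(\<lambda>(x, y). k x y) = (\<lambda>p. ennreal (h (snd p)) * (ennreal (log_weight (fst p) powr e * norm (snd p - fst p) powr - \<nu>) *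
        indicator {p. dist (fst p) (snd p) < log_radius (fst p)} p))"
      unfolding k_def by (auto split: split_indicator)
    also have "\<dots> \<in> borel_measurable (lborel \<Otimes>\<^sub>M lborel)" by measurable
    finally show ?thesis .
  qed
  have "(\<integral>\<^sup>+x. ennreal (log_weight x) * (ennreal (log_radius x powr \<nu>) *
      (\<integral>\<^sup>+y. ennreal (h y * norm (y - x) powr - \<nu>) * indicator (ball x (log_radius x)) y \<partial>lborel)) \<partial>lborel)
    = (\<integral>\<^sup>+x. (\<integral>\<^sup>+y. k x y \<partial>lborel) \<partial>lborel)"
  proof (rule nn_integral_cong)
    fix x :: 'a
    have w: "log_weight x > 0" using log_weight_ge_1[of x] by simp
    let ?g = "\<lambda>y. ennreal (h y * norm (y - x) powr - \<nu>) * indicator (ball x (log_radius x)) y"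
    have "log_weight x * log_radius x powr \<nu> = log_weight x powr e"
    proof -
      have "log_radius x powr \<nu> = log_weight x powr - (\<nu> / n)"
        unfolding log_radius_def powr_powr n_def by simp
      moreover have "log_weight x powr e = log_weight x powr 1 * log_weight x powr - (\<nu> / n)"
        unfolding e_def powr_add[symmetric] by simp
      ultimately show ?thesis using w by simp
    qed
    then have "ennreal (log_weight x powr e) = ennreal (log_weight x) * ennreal (log_radius x powr \<nu>)"
      using w by (metis ennreal_mult less_imp_le powr_ge_zero)
    then have "ennreal (log_weight x) * (ennreal (log_radius x powr \<nu>) * (\<integral>\<^sup>+y. ?g y \<partial>lborel)) = ennreal (log_weight x powr e) * (\<integral>\<^sup>+y. ?g y \<partial>lborel)"
      by (simp only: mult.assoc)
    also have "\<dots> = (\<integral>\<^sup>+y. ennreal (log_weight x powr e) * ?g y \<partial>lborel)"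
      by (intro nn_integral_cmult[symmetric] borel_measurable_times_ennreal borel_measurable_indicator) auto
    also have "\<dots> = (\<integral>\<^sup>+y. k x y \<partial>lborel)"
    proof (rule nn_integral_cong)
      fix y
      show "ennreal (log_weight x powr e) * ?g y = k x y"
        unfolding k_def using h[of y]
        by (cases "dist x y < log_radius x") (simp_all add: ennreal_mult mult.left_commute)
    qed
    finally show "ennreal (log_weight x) * (ennreal (log_radius x powr \<nu>) * (\<integral>\<^sup>+y. ?g y \<partial>lborel)) = (\<integral>\<^sup>+y. k x y \<partial>lborel)" .
  qed
  also have "\<dots> = (\<integral>\<^sup>+y. (\<integral>\<^sup>+x. k x y \<partial>lborel) \<partial>lborel)"
    by (rule lborel_pair.Fubini'[symmetric, OF k_meas])
  also have "\<dots> \<le> (\<integral>\<^sup>+y. ennreal (4 powr e * (n * unit_ball_vol n / (n - \<nu>))) * ennreal (h y) \<partial>lborel)"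
  proof (rule nn_integral_mono)
    fix y :: 'a
    \<comment> \<open>The admissible radius depends on the variable \<open>x\<close>. As
      \<open>log_weight x\<close> is at least half of \<open>log_weight y\<close>, this
      \<open>r\<close> bounds all radii that occur; the two factors 2^e combine to 4^e.\<close>
    define r where "r = (log_weight y / 2) powr (- 1 / n)"
    have w: "log_weight y > 0" using log_weight_ge_1[of y] by simp
    have "(\<integral>\<^sup>+x. k x y \<partial>lborel) \<le> (\<integral>\<^sup>+x. ennreal (h y) * (ennreal ((2 * log_weight y) powr e) * (ennreal (norm (x - y) powr - \<nu>) * indicator (ball y r) x)) \<partial>lborel)"
    proof (rule nn_integral_mono)
      fix x :: 'a
      show "k x y \<le> ennreal (h y) * (ennreal ((2 * log_weight y) powr e) * (ennreal (norm (x - y) powr - \<nu>) * indicator (ball y r) x))"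
      proof (cases "dist x y < log_radius x")
        case True
        then have d: "dist x y \<le> 1" using log_radius_le_1[of x] by linarith
        have "log_weight x \<le> 2 * log_weight y" by (rule log_weight_le_double[OF d])
        then have w1: "log_weight x powr e \<le> (2 * log_weight y) powr e"
          using log_weight_ge_1[of x] e by (intro powr_mono2) auto
        have "log_weight y / 2 \<le> log_weight x"
          using log_weight_le_double[of y x] d by (simp add: dist_commute)
        then have "log_radius x \<le> r"
          using w n unfolding r_def log_radius_def n_def by (intro powr_mono2') auto
        then have "x \<in> ball y r" using True by (simp add: dist_commute)
        have "k x y = ennreal (h y) * ennreal (log_weight x powr e * norm (x - y) powr - \<nu>)"
          using True unfolding k_def norm_minus_commute[of y x] by simp
        also have "\<dots> \<le> ennreal (h y) * ennreal ((2 * log_weight y) powr e * norm (x - y) powr - \<nu>)"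
          by (intro mult_left_mono ennreal_leI mult_right_mono w1) auto
        also have "\<dots> = ennreal (h y) * (ennreal ((2 * log_weight y) powr e) * (ennreal (norm (x - y) powr - \<nu>) * indicator (ball y r) x))"
          using \<open>x \<in> ball y r\<close> by (simp only: indicator_simps mult_1_right ennreal_mult powr_ge_zero)
        finally show ?thesis .
      qed (simp add: k_def)
    qed
    also have "\<dots> = ennreal (h y) * (ennreal ((2 * log_weight y) powr e) * (\<integral>\<^sup>+x. ennreal (norm (x - y) powr - \<nu>) * indicator (ball y r) x \<partial>lborel))"
      by (subst nn_integral_cmult, intro borel_measurable_times_ennreal borel_measurable_indicator)
         (auto intro!: nn_integral_cmult borel_measurable_times_ennreal borel_measurable_indicator arg_cong2[of _ _ _ _ "(*)"])
    also have "(\<integral>\<^sup>+x. ennreal (norm (x - y) powr - \<nu>) * indicator (ball y r) x \<partial>lborel) = ennreal (n * unit_ball_vol n / (n - \<nu>) * r powr (n - \<nu>))"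
      using \<nu> unfolding n_def by (intro nn_integral_power_kernel) (auto simp: r_def)
    also have "ennreal ((2 * log_weight y) powr e) * \<dots> = ennreal (4 powr e * (n * unit_ball_vol n / (n - \<nu>)))"
    proof -
      have "- 1 / n * (n - \<nu>) = - e" using n by (simp add: e_def field_simps)
      then have "r powr (n - \<nu>) = (log_weight y / 2) powr - e"
        unfolding r_def powr_powr by simp
      also have "\<dots> = 2 powr e / log_weight y powr e"
        using w by (simp add: powr_minus_divide powr_divide)
      finally have "(2 * log_weight y) powr e * r powr (n - \<nu>) = 2 powr e * 2 powr e"
        using w by (simp add: powr_mult)
      also have "\<dots> = 4 powr e" using powr_mult[of 2 2 e] by simp
      finally have "(2 * log_weight y) powr e * (n * unit_ball_vol n / (n - \<nu>) * r powr (n - \<nu>)) = 4 powr e * (n * unit_ball_vol n / (n - \<nu>))"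
        by (simp add: mult.left_commute)
      then show ?thesis
        by (subst ennreal_mult'[symmetric]) (use \<nu> n in auto)
    qed
    finally show "(\<integral>\<^sup>+x. k x y \<partial>lborel) \<le> ennreal (4 powr e * (n * unit_ball_vol n / (n - \<nu>))) * ennreal (h y)"
      by (simp add: mult.commute)
  qed
  also have "\<dots> = ennreal (4 powr e * (n * unit_ball_vol n / (n - \<nu>))) * (\<integral>\<^sup>+y. ennreal (h y) \<partial>lborel)"
    by (simp add: nn_integral_cmult)
  finally show ?thesis unfolding e_def .
qed

lemma test_function_uniform_bound:
  fixes \<alpha> q :: real and F :: "real \<Rightarrow> real"
  assumes dim: "DIM('a::euclidean_space) \<ge> 2" and q: "q \<ge> 1" and \<alpha>: "0 < \<alpha>" "\<alpha> < 1"
    and F0: "\<exists>C>0. \<forall>s\<in>{0..1}. F s \<le> C * s powr q"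
    and F1: "\<And>b. b > critical_alpha TYPE('a) \<Longrightarrow>
      \<exists>C>0. \<forall>s\<ge>1. F s \<le> C * exp (b * s powr (real DIM('a) / (real DIM('a) - 1)))"
  shows "\<exists>C. \<forall>u::'a \<Rightarrow> real. test_function u \<longrightarrow> (\<integral>\<^sup>+y. ennreal (\<bar>u y\<bar> powr q) \<partial>log_measure) \<le> 1 \<longrightarrow>
      (\<integral>\<^sup>+y. ennreal (norm (grad u y) powr real DIM('a)) \<partial>lborel) \<le> 1 \<longrightarrow>
      (\<integral>\<^sup>+x. ennreal (F (\<alpha> * \<bar>u x\<bar>)) \<partial>log_measure) \<le> ennreal C"
proof -
  define n where "n = real DIM('a)"
  obtain b \<nu> C where b: "b > critical_alpha TYPE('a)" and \<nu>: "0 < \<nu>" "\<nu> < n" and C: "C > 0"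
    and expb: "\<And>u (x::'a). test_function u \<Longrightarrow> (\<integral>\<^sup>+y. ennreal (\<bar>u y\<bar> powr q) \<partial>log_measure) \<le> 1 \<Longrightarrow>
      (\<integral>\<^sup>+y. ennreal (norm (grad u y) powr n) \<partial>lborel) \<le> 1 \<Longrightarrow>
      ennreal (exp (b * (\<alpha> * \<bar>u x\<bar>) powr (n / (n - 1)))) \<le> ennreal C * (1 + ennreal (log_radius x powr \<nu>) *
        (\<integral>\<^sup>+y. ennreal (norm (grad u y) powr n * norm (y - x) powr - \<nu>) * indicator (ball x (log_radius x)) y \<partial>lborel))"
    using test_function_exp_bound[where 'a = 'a, OF dim q \<alpha>] unfolding n_def[symmetric] by blast
  obtain C1 where C1: "C1 > 0" "\<And>s. s \<in> {0..1} \<Longrightarrow> F s \<le> C1 * s powr q" using F0 by blast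
  obtain C2 where C2: "C2 > 0" "\<And>s. s \<ge> 1 \<Longrightarrow> F s \<le> C2 * exp (b * s powr (n / (n - 1)))"
    using F1[OF b] unfolding n_def by blast
  define K where "K = C1 + C2 * C"
  have K: "K > 0" "C1 \<le> K" "C2 * C \<le> K" using C C1 C2 by (simp_all add: K_def add_pos_pos)
  define K' where "K' = 4 powr (1 - \<nu> / n) * (n * unit_ball_vol n / (n - \<nu>))"
  have K': "K' \<ge> 0" using \<nu> by (simp add: K'_def n_def)
  show ?thesis
  proof (intro exI[of _ "K * (1 + K')"] allI impI)
    fix u :: "'a \<Rightarrow> real"
    assume u: "test_function u" and u1: "(\<integral>\<^sup>+y. ennreal (\<bar>u y\<bar> powr q) \<partial>log_measure) \<le> 1"
      and u2: "(\<integral>\<^sup>+y. ennreal (norm (grad u y) powr real DIM('a)) \<partial>lborel) \<le> 1"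
    have um [measurable]: "u \<in> borel_measurable borel" "(\<lambda>y. norm (grad u y)) \<in> borel_measurable borel"
      using test_function_continuous[OF u] test_function_grad_continuous[OF u]
      by (auto intro!: borel_measurable_continuous_onI continuous_intros)
    define G where "G = (\<lambda>x. ennreal (log_radius x powr \<nu>) *
        (\<integral>\<^sup>+y. ennreal (norm (grad u y) powr n * norm (y - x) powr - \<nu>) * indicator (ball x (log_radius x)) y \<partial>lborel))"
    have [measurable]: "G \<in> borel_measurable borel"
    proof -
      have "(\<lambda>(x, y). ennreal (norm (grad u y) powr n * norm (y - x) powr - \<nu>) * indicator (ball x (log_radius x)) y)
        = (\<lambda>p. ennreal (norm (grad u (snd p)) powr n * norm (snd p - fst p) powr - \<nu>) * indicator {p. dist (fst p) (snd p) < log_radius (fst p)} p)"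
        by (auto split: split_indicator)
      also have "\<dots> \<in> borel_measurable (borel \<Otimes>\<^sub>M lborel)" by measurable
      finally have "(\<lambda>x. \<integral>\<^sup>+y. ennreal (norm (grad u y) powr n * norm (y - x) powr - \<nu>) * indicator (ball x (log_radius x)) y \<partial>lborel) \<in> borel_measurable borel"
        by (intro lborel.borel_measurable_nn_integral) simp
      then show ?thesis unfolding G_def by measurable
    qed
    have pt: "ennreal (F (\<alpha> * \<bar>u x\<bar>)) \<le> ennreal K * (ennreal (\<bar>u x\<bar> powr q) + G x)" for x
    proof (cases "\<alpha> * \<bar>u x\<bar> \<le> 1")
      case True
      have "F (\<alpha> * \<bar>u x\<bar>) \<le> C1 * (\<alpha> * \<bar>u x\<bar>) powr q"
        using True \<alpha> by (intro C1) auto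
      also have "\<dots> \<le> K * \<bar>u x\<bar> powr q"
        using \<alpha> q C1 K by (intro mult_mono powr_mono2) (auto intro: mult_left_le_one_le)
      finally have "ennreal (F (\<alpha> * \<bar>u x\<bar>)) \<le> ennreal K * ennreal (\<bar>u x\<bar> powr q)"
        using K by (subst ennreal_mult[symmetric]) (auto intro: ennreal_leI)
      also have "\<dots> \<le> ennreal K * (ennreal (\<bar>u x\<bar> powr q) + G x)"
        by (intro mult_left_mono) auto
      finally show ?thesis .
    next
      case False
      then have "\<alpha> * \<bar>u x\<bar> \<ge> 1" by simp
      moreover have "\<alpha> * \<bar>u x\<bar> \<le> 1 * \<bar>u x\<bar>" using \<alpha> by (intro mult_right_mono) auto
      ultimately have "\<bar>u x\<bar> \<ge> 1" by linarith
      then have "\<bar>u x\<bar> powr q \<ge> 1" using q by (simp add: ge_one_powr_ge_zero)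
      \<comment> \<open>Here the non-integrable summand 1 of the exponential bound is traded for
        |u|^q.\<close>
      then have 1: "1 \<le> ennreal (\<bar>u x\<bar> powr q)" using ennreal_leI by fastforce
      have "ennreal (F (\<alpha> * \<bar>u x\<bar>)) \<le> ennreal C2 * ennreal (exp (b * (\<alpha> * \<bar>u x\<bar>) powr (n / (n - 1))))"
        using C2(1) C2(2)[OF \<open>\<alpha> * \<bar>u x\<bar> \<ge> 1\<close>] by (subst ennreal_mult[symmetric]) (auto intro: ennreal_leI)
      also have "\<dots> \<le> ennreal C2 * (ennreal C * (1 + G x))"
        using expb[OF u u1, of x] u2 unfolding G_def n_def[symmetric] by (intro mult_left_mono) auto
      also have "\<dots> = ennreal (C2 * C) * (1 + G x)"
        using C2 C by (simp add: ennreal_mult mult.assoc)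
      also have "\<dots> \<le> ennreal K * (ennreal (\<bar>u x\<bar> powr q) + G x)"
        using 1 K by (intro mult_mono add_mono ennreal_leI) auto
      finally show ?thesis .
    qed
    have [measurable]: "G \<in> borel_measurable lebesgue" "u \<in> borel_measurable lebesgue"
      by (auto intro!: measurable_completion)
    have [measurable]: "log_weight \<in> borel_measurable (lebesgue :: 'a measure)"
      by (auto intro!: measurable_completion)
    have meq: "measurable log_measure borel = measurable (lebesgue :: 'a measure) (borel :: ennreal measure)"
      by (rule measurable_cong_sets) (auto simp: log_measure_def)
    have "(\<integral>\<^sup>+x. ennreal (F (\<alpha> * \<bar>u x\<bar>)) \<partial>log_measure) \<le> (\<integral>\<^sup>+x. ennreal K * (ennreal (\<bar>u x\<bar> powr q) + G x) \<partial>log_measure)"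
      by (intro nn_integral_mono pt)
    also have "\<dots> = ennreal K * ((\<integral>\<^sup>+x. ennreal (\<bar>u x\<bar> powr q) \<partial>log_measure) + (\<integral>\<^sup>+x. G x \<partial>log_measure))"
      by (subst nn_integral_cmult, simp add: meq, subst nn_integral_add) (simp_all add: meq)
    also have "\<dots> \<le> ennreal K * (1 + ennreal K' * 1)"
    proof (intro mult_left_mono add_mono u1)
      have "(\<integral>\<^sup>+x. G x \<partial>log_measure) = (\<integral>\<^sup>+x. ennreal (log_weight x) * G x \<partial>lborel)"
        by (subst nn_integral_log_measure) (auto simp: nn_integral_completion)
      also have "\<dots> \<le> ennreal K' * (\<integral>\<^sup>+y. ennreal (norm (grad u y) powr n) \<partial>lborel)"
        unfolding G_def K'_def n_def using \<nu>[unfolded n_def]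
        by (intro weighted_potential_integral) auto
      also have "\<dots> \<le> ennreal K' * 1"
        using u2 unfolding n_def by (intro mult_left_mono) auto
      finally show "(\<integral>\<^sup>+x. G x \<partial>log_measure) \<le> ennreal K' * 1" .
    qed auto
    also have "\<dots> = ennreal (K * (1 + K'))"
      using K K' by (simp add: ennreal_mult)
    finally show "(\<integral>\<^sup>+x. ennreal (F (\<alpha> * \<bar>u x\<bar>)) \<partial>log_measure) \<le> ennreal (K * (1 + K'))" .
  qed
qed

section \<open>Passage to the completion\<close>

text \<open>The L1 subsequence theorem asks for integrable functions, so the terms before the
  integrals drop below 1 are discarded and the indices shifted by \<open>k\<close>.\<close>

lemma nn_integral_AE_subseq:
  fixes d :: "nat \<Rightarrow> 'a \<Rightarrow> real"
  assumes [measurable]: "\<And>n. d n \<in> borel_measurable M" and nonneg: "\<And>n x. d n x \<ge> 0"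
    and lim: "(\<lambda>n. \<integral>\<^sup>+x. ennreal (d n x) \<partial>M) \<longlonglongrightarrow> 0"
  shows "\<exists>r. strict_mono r \<and> (AE x in M. (\<lambda>n. d (r n) x) \<longlonglongrightarrow> 0)"
proof -
  have "\<forall>\<^sub>F n in sequentially. (\<integral>\<^sup>+x. ennreal (d n x) \<partial>M) < 1"
    using lim by (rule order_tendstoD) simp
  then obtain k where k: "\<And>n. n \<ge> k \<Longrightarrow> (\<integral>\<^sup>+x. ennreal (d n x) \<partial>M) < 1"
    unfolding eventually_sequentially by blast
  have fin: "(\<integral>\<^sup>+x. ennreal (d (n + k) x) \<partial>M) < \<infinity>" for n
    using k[of "n + k"] by (simp add: less_top order.strict_trans2)
  have int: "integrable M (d (n + k))" for n
    using fin[of n] nonneg by (simp add: integrable_iff_bounded)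
  have eq: "(\<integral>\<^sup>+x. ennreal (d (n + k) x) \<partial>M) = ennreal (\<integral>x. norm (d (n + k) x) \<partial>M)" for n
    using nonneg int by (subst nn_integral_eq_integral[symmetric]) auto
  have "(\<lambda>n. \<integral>\<^sup>+x. ennreal (d (n + k) x) \<partial>M) \<longlonglongrightarrow> 0"
    using lim by (rule LIMSEQ_ignore_initial_segment)
  then have "(\<lambda>n. ennreal (\<integral>x. norm (d (n + k) x) \<partial>M)) \<longlonglongrightarrow> ennreal 0"
    unfolding eq by simp
  then have "(\<lambda>n. \<integral>x. norm (d (n + k) x) \<partial>M) \<longlonglongrightarrow> 0"
    by (rule tendsto_ennrealD) (auto intro!: always_eventually integral_nonneg_AE)
  then obtain r :: "nat \<Rightarrow> nat" where r: "strict_mono r" "AE x in M. (\<lambda>n. d (r n + k) x) \<longlonglongrightarrow> 0"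
    using tendsto_L1_AE_subseq[of M "\<lambda>n. d (n + k)"] int by blast
  have "strict_mono (\<lambda>n. r n + k)"
    using r(1) by (auto simp: strict_mono_def)
  then show ?thesis using r(2) by blast
qed

text \<open>Approximants of a function of norm at most 1 may have norm slightly above 1; dividing by
  1 + t brings them back. It serves for both |u| and the norm of the gradient, with \<open>d\<close>
  the size of the difference.\<close>

lemma eventually_normalized_le_1:
  fixes f d :: "nat \<Rightarrow> 'a \<Rightarrow> real" and g :: "'a \<Rightarrow> real"
  assumes [measurable]: "\<And>n. f n \<in> borel_measurable M" "\<And>n. d n \<in> borel_measurable M" "g \<in> borel_measurable M"
    and nonneg: "\<And>n x. 0 \<le> f n x" "\<And>n x. 0 \<le> d n x" "\<And>x. 0 \<le> g x"
    and tri: "\<And>n x. f n x \<le> g x + d n x"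
    and g: "(\<integral>\<^sup>+x. ennreal (g x powr p) \<partial>M) \<le> 1"
    and d: "(\<lambda>n. \<integral>\<^sup>+x. ennreal (d n x powr p) \<partial>M) \<longlonglongrightarrow> 0"
    and "p > 0" "t > 0"
  shows "\<forall>\<^sub>F n in sequentially. (\<integral>\<^sup>+x. ennreal ((f n x / (1 + t)) powr p) \<partial>M) \<le> 1"
proof -
  \<comment> \<open>Splitting with \<open>s\<close> < \<open>t\<close> makes the coefficient
    \<open>A\<close> of the limit strictly less than 1, so 1 - A is left for the error term.\<close>
  define s where "s = t / 2"
  have s: "s > 0" "s < t" using assms by (auto simp: s_def)
  define A where "A = ((1 + s) / (1 + t)) powr p"
  have A: "0 < A" "A < 1"
    using s \<open>p > 0\<close> powr_less_mono2[of p "(1 + s) / (1 + t)" 1] by (auto simp: A_def)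
  define B where "B = ((1 + 1 / s) / (1 + t)) powr p"
  have B: "0 < B"
    using s by (auto simp: B_def add_pos_pos less_imp_neq[THEN not_sym])
  have "\<forall>\<^sub>F n in sequentially. (\<integral>\<^sup>+x. ennreal (d n x powr p) \<partial>M) < ennreal ((1 - A) / B)"
    using d A B by (intro order_tendstoD[OF d]) auto
  then show ?thesis
  proof eventually_elim
    case (elim n)
    have pt: "(f n x / (1 + t)) powr p \<le> A * g x powr p + B * d n x powr p" for x
    proof -
      have "(f n x / (1 + t)) powr p \<le> ((g x + d n x) / (1 + t)) powr p"
        using tri[of n x] nonneg assms by (intro powr_mono2 divide_right_mono) auto
      also have "\<dots> = (g x + d n x) powr p / (1 + t) powr p"
        using nonneg assms by (simp add: powr_divide)
      also have "\<dots> \<le> ((1 + s) powr p * g x powr p + (1 + 1 / s) powr p * d n x powr p) / (1 + t) powr p"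
        using nonneg assms s by (intro divide_right_mono powr_add_le) auto
      also have "\<dots> = A * g x powr p + B * d n x powr p"
      proof -
        have "A = (1 + s) powr p / (1 + t) powr p" "B = (1 + 1 / s) powr p / (1 + t) powr p"
          unfolding A_def B_def using s by (auto intro!: powr_divide)
        then show ?thesis by (simp only: add_divide_distrib times_divide_eq_left)
      qed
      finally show ?thesis .
    qed
    have "(\<integral>\<^sup>+x. ennreal ((f n x / (1 + t)) powr p) \<partial>M) \<le> (\<integral>\<^sup>+x. ennreal A * ennreal (g x powr p) + ennreal B * ennreal (d n x powr p) \<partial>M)"
    proof (rule nn_integral_mono)
      fix x
      have "ennreal ((f n x / (1 + t)) powr p) \<le> ennreal (A * g x powr p + B * d n x powr p)"
        by (intro ennreal_leI pt)
      also have "\<dots> = ennreal A * ennreal (g x powr p) + ennreal B * ennreal (d n x powr p)"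
        using A B by (simp add: ennreal_mult)
      finally show "ennreal ((f n x / (1 + t)) powr p) \<le> \<dots>" .
    qed
    also have "\<dots> = ennreal A * (\<integral>\<^sup>+x. ennreal (g x powr p) \<partial>M) + ennreal B * (\<integral>\<^sup>+x. ennreal (d n x powr p) \<partial>M)"
      by (simp add: nn_integral_add nn_integral_cmult)
    also have "\<dots> \<le> ennreal A * 1 + ennreal B * ennreal ((1 - A) / B)"
      using elim by (intro add_mono mult_left_mono g) auto
    also have "\<dots> = 1"
      using A B by (simp flip: ennreal_mult ennreal_plus)
    finally show ?case .
  qed
qed

lemma measurable_log_measure_eq: "measurable (log_measure :: 'a::euclidean_space measure) M = measurable lebesgue M"
  by (rule measurable_cong_sets) (auto simp: log_measure_def)

lemma test_function_measurable:
  assumes "test_function (g :: 'a::euclidean_space \<Rightarrow> real)"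
  shows "g \<in> borel_measurable lebesgue" "grad g \<in> borel_measurable lebesgue"
  using assms[THEN test_function_continuous] assms[THEN test_function_grad_continuous]
  by (auto intro!: measurable_completion borel_measurable_continuous_onI)

lemma norm_powr_DIM: "norm (v :: 'a::euclidean_space) powr real DIM('a) = norm v ^ DIM('a)"
  by (simp add: powr_realpow')

lemma W_spaceE:
  fixes u :: "'a::euclidean_space \<Rightarrow> real"
  assumes "(u, G) \<in> W_space q"
  obtains \<phi> where "u \<in> borel_measurable lebesgue" "G \<in> borel_measurable lebesgue"
    "\<And>n. test_function (\<phi> n)"
    "(\<lambda>n. \<integral>\<^sup>+x. ennreal (\<bar>u x - \<phi> n x\<bar> powr q) \<partial>log_measure) \<longlonglongrightarrow> 0"
    "(\<lambda>n. \<integral>\<^sup>+x. ennreal (norm (G x - grad (\<phi> n) x) powr real DIM('a)) \<partial>lebesgue) \<longlonglongrightarrow> 0"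
  using assms unfolding W_space_def norm_powr_DIM by blast

lemma W_space_affine:
  fixes u \<phi> :: "'a::euclidean_space \<Rightarrow> real"
  assumes W: "(u, G) \<in> W_space q" and \<phi>: "test_function \<phi>" and "c > 0"
  shows "(\<lambda>x. c * (u x - \<phi> x), \<lambda>x. c *\<^sub>R (G x - grad \<phi> x)) \<in> W_space q"
proof -
  obtain \<psi> where m [measurable]: "u \<in> borel_measurable lebesgue" "G \<in> borel_measurable lebesgue"
    and \<psi>: "\<And>n. test_function (\<psi> n)"
    and lim: "(\<lambda>n. \<integral>\<^sup>+x. ennreal (\<bar>u x - \<psi> n x\<bar> powr q) \<partial>log_measure) \<longlonglongrightarrow> 0"
      "(\<lambda>n. \<integral>\<^sup>+x. ennreal (norm (G x - grad (\<psi> n) x) powr real DIM('a)) \<partial>lebesgue) \<longlonglongrightarrow> 0"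
    using W by (rule W_spaceE) blast
  note test_function_measurable[OF \<phi>, measurable] test_function_measurable[OF \<psi>, measurable]
  let ?\<psi> = "\<lambda>n x. c * \<psi> n x + (- c) * \<phi> x"
  have t: "test_function (?\<psi> n)" "grad (?\<psi> n) x = c *\<^sub>R grad (\<psi> n) x + (- c) *\<^sub>R grad \<phi> x" for n x
    by (rule test_function_linear_combination[OF \<psi> \<phi>])+
  have "(\<integral>\<^sup>+x. ennreal (\<bar>c * (u x - \<phi> x) - ?\<psi> n x\<bar> powr q) \<partial>log_measure)
      = ennreal (c powr q) * (\<integral>\<^sup>+x. ennreal (\<bar>u x - \<psi> n x\<bar> powr q) \<partial>log_measure)" for n
  proof -
    have "c * (u x - \<phi> x) - ?\<psi> n x = c * (u x - \<psi> n x)" for x by (simp add: algebra_simps)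
    then have "ennreal (\<bar>c * (u x - \<phi> x) - ?\<psi> n x\<bar> powr q) = ennreal (c powr q) * ennreal (\<bar>u x - \<psi> n x\<bar> powr q)" for x
      using \<open>c > 0\<close> by (simp add: abs_mult powr_mult ennreal_mult del: right_diff_distrib)
    then show ?thesis
      by (simp add: nn_integral_cmult measurable_log_measure_eq)
  qed
  then have 1: "(\<lambda>n. \<integral>\<^sup>+x. ennreal (\<bar>c * (u x - \<phi> x) - ?\<psi> n x\<bar> powr q) \<partial>log_measure) \<longlonglongrightarrow> 0"
    using ennreal_tendsto_cmult[OF _ lim(1), of "ennreal (c powr q)"] by simp
  have "(\<integral>\<^sup>+x. ennreal (norm (c *\<^sub>R (G x - grad \<phi> x) - grad (?\<psi> n) x) powr real DIM('a)) \<partial>lebesgue)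
      = ennreal (c powr real DIM('a)) * (\<integral>\<^sup>+x. ennreal (norm (G x - grad (\<psi> n) x) powr real DIM('a)) \<partial>lebesgue)" for n
  proof -
    have "c *\<^sub>R (G x - grad \<phi> x) - grad (?\<psi> n) x = c *\<^sub>R (G x - grad (\<psi> n) x)" for x
      unfolding t(2) by (simp add: algebra_simps)
    then have "ennreal (norm (c *\<^sub>R (G x - grad \<phi> x) - grad (?\<psi> n) x) powr real DIM('a)) = ennreal (c powr real DIM('a)) * ennreal (norm (G x - grad (\<psi> n) x) powr real DIM('a))" for x
      using \<open>c > 0\<close> by (simp only: norm_scaleR) (simp add: powr_mult ennreal_mult del: powr_numeral)
    then show ?thesis
      by (simp add: nn_integral_cmult)
  qed
  then have 2: "(\<lambda>n. \<integral>\<^sup>+x. ennreal (norm (c *\<^sub>R (G x - grad \<phi> x) - grad (?\<psi> n) x) powr real DIM('a)) \<partial>lebesgue) \<longlonglongrightarrow> 0"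
    using ennreal_tendsto_cmult[OF _ lim(2), of "ennreal (c powr real DIM('a))"] by simp
  show ?thesis
    unfolding W_space_def norm_powr_DIM[symmetric] mem_Collect_eq case_prod_conv
  proof (intro conjI exI[of _ ?\<psi>] allI)
    show "(\<lambda>x. c * (u x - \<phi> x)) \<in> borel_measurable lebesgue" "(\<lambda>x. c *\<^sub>R (G x - grad \<phi> x)) \<in> borel_measurable lebesgue"
      by measurable
  qed (fact t(1) 1 2)+
qed

lemma W_space_uniform_bound:
  fixes \<alpha> q :: real and F :: "real \<Rightarrow> real"
  assumes dim: "DIM('a::euclidean_space) \<ge> 2" and q: "q \<ge> 1" and \<alpha>: "0 < \<alpha>" "\<alpha> < 1"
    and F: "continuous_on UNIV F"
    and F0: "\<exists>C>0. \<forall>s\<in>{0..1}. F s \<le> C * s powr q"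
    and F1: "\<And>b. b > critical_alpha TYPE('a) \<Longrightarrow>
      \<exists>C>0. \<forall>s\<ge>1. F s \<le> C * exp (b * s powr (real DIM('a) / (real DIM('a) - 1)))"
  shows "\<exists>C. \<forall>(u :: 'a \<Rightarrow> real, G)\<in>W_space q. (\<integral>\<^sup>+y. ennreal (\<bar>u y\<bar> powr q) \<partial>log_measure) \<le> 1 \<longrightarrow>
      (\<integral>\<^sup>+y. ennreal (norm (G y) powr real DIM('a)) \<partial>lebesgue) \<le> 1 \<longrightarrow>
      (\<integral>\<^sup>+x. ennreal (F (\<alpha> * \<bar>u x\<bar>)) \<partial>log_measure) \<le> ennreal C"
proof -
  \<comment> \<open>Then \<alpha> (1 + t) = (1 + \<alpha>) / 2 < 1, so the test function bound
    applies to the approximants divided by 1 + t.\<close>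
  define t where "t = (1 / \<alpha> - 1) / 2"
  have t: "t > 0" "\<alpha> * (1 + t) < 1" using \<alpha> by (auto simp: t_def field_simps)
  obtain C where C: "\<And>u::'a \<Rightarrow> real. test_function u \<Longrightarrow> (\<integral>\<^sup>+y. ennreal (\<bar>u y\<bar> powr q) \<partial>log_measure) \<le> 1 \<Longrightarrow>
      (\<integral>\<^sup>+y. ennreal (norm (grad u y) powr real DIM('a)) \<partial>lborel) \<le> 1 \<Longrightarrow>
      (\<integral>\<^sup>+x. ennreal (F (\<alpha> * (1 + t) * \<bar>u x\<bar>)) \<partial>log_measure) \<le> ennreal C"
    using test_function_uniform_bound[OF dim q _ t(2) F0 F1] \<alpha> t by auto
  show ?thesis
  proof (intro exI[of _ C] ballI, clarify)
    fix u :: "'a \<Rightarrow> real" and G :: "'a \<Rightarrow> 'a"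
    assume W: "(u, G) \<in> W_space q" and u1: "(\<integral>\<^sup>+y. ennreal (\<bar>u y\<bar> powr q) \<partial>log_measure) \<le> 1"
      and G1: "(\<integral>\<^sup>+y. ennreal (norm (G y) powr real DIM('a)) \<partial>lebesgue) \<le> 1"
    obtain \<phi> where m [measurable]: "u \<in> borel_measurable lebesgue" "G \<in> borel_measurable lebesgue"
      and \<phi>: "\<And>n. test_function (\<phi> n)"
      and lim: "(\<lambda>n. \<integral>\<^sup>+x. ennreal (\<bar>u x - \<phi> n x\<bar> powr q) \<partial>log_measure) \<longlonglongrightarrow> 0"
        "(\<lambda>n. \<integral>\<^sup>+x. ennreal (norm (G x - grad (\<phi> n) x) powr real DIM('a)) \<partial>lebesgue) \<longlonglongrightarrow> 0"
      using W by (rule W_spaceE) blast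
    note test_function_measurable[OF \<phi>, measurable]
    note measurable_log_measure_eq[simp]
    have F_meas [measurable]: "F \<in> borel_measurable borel"
      using F by (rule borel_measurable_continuous_onI)
    have 1: "\<forall>\<^sub>F n in sequentially. (\<integral>\<^sup>+x. ennreal ((\<bar>\<phi> n x\<bar> / (1 + t)) powr q) \<partial>log_measure) \<le> 1"
      using q t by (intro eventually_normalized_le_1[OF _ _ _ _ _ _ _ u1 lim(1)]) auto
    have "norm (grad (\<phi> n) x) \<le> norm (G x) + norm (G x - grad (\<phi> n) x)" for n x
      using norm_triangle_sub[of "grad (\<phi> n) x" "G x"] by (simp add: norm_minus_commute)
    then have 2: "\<forall>\<^sub>F n in sequentially. (\<integral>\<^sup>+x. ennreal ((norm (grad (\<phi> n) x) / (1 + t)) powr real DIM('a)) \<partial>lebesgue) \<le> 1"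
      using t by (intro eventually_normalized_le_1[OF _ _ _ _ _ _ _ G1 lim(2)]) auto
    have bound: "\<forall>\<^sub>F n in sequentially. (\<integral>\<^sup>+x. ennreal (F (\<alpha> * \<bar>\<phi> n x\<bar>)) \<partial>log_measure) \<le> ennreal C"
      using 1 2
    proof eventually_elim
      case (elim n)
      let ?\<psi> = "\<lambda>x. 1 / (1 + t) * \<phi> n x + 0 * \<phi> n x"
      have psi: "test_function ?\<psi>" "grad ?\<psi> x = (1 / (1 + t)) *\<^sub>R grad (\<phi> n) x" for x
        using test_function_linear_combination[OF \<phi>[of n] \<phi>[of n], of "1 / (1 + t)" 0] by auto
      have abs: "\<bar>?\<psi> x\<bar> = \<bar>\<phi> n x\<bar> / (1 + t)" for x using t by simp
      have nrm: "norm (grad ?\<psi> x) = norm (grad (\<phi> n) x) / (1 + t)" for x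
        unfolding psi(2) using t by simp
      have "(\<integral>\<^sup>+x. ennreal (F (\<alpha> * (1 + t) * \<bar>?\<psi> x\<bar>)) \<partial>log_measure) \<le> ennreal C"
        using elim by (intro C psi(1)) (simp_all only: abs nrm nn_integral_completion)
      moreover have "\<alpha> * (1 + t) * \<bar>?\<psi> x\<bar> = \<alpha> * \<bar>\<phi> n x\<bar>" for x
        unfolding abs using t by simp
      ultimately show ?case by simp
    qed
    obtain r :: "nat \<Rightarrow> nat" where r: "strict_mono r"
      "AE x in log_measure. (\<lambda>n. \<bar>u x - \<phi> (r n) x\<bar> powr q) \<longlonglongrightarrow> 0"
      using nn_integral_AE_subseq[OF _ _ lim(1)] by auto
    have AE: "AE x in log_measure. (\<lambda>n. ennreal (F (\<alpha> * \<bar>\<phi> (r n) x\<bar>))) \<longlonglongrightarrow> ennreal (F (\<alpha> * \<bar>u x\<bar>))"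
      using r(2)
    proof eventually_elim
      case (elim x)
      have "(\<lambda>n. (\<bar>u x - \<phi> (r n) x\<bar> powr q) powr (1 / q)) \<longlonglongrightarrow> 0 powr (1 / q)"
        using q elim by (intro tendsto_powr') auto
      then have "(\<lambda>n. \<bar>u x - \<phi> (r n) x\<bar>) \<longlonglongrightarrow> 0"
        using q by (simp add: powr_powr)
      then have "(\<lambda>n. u x - \<phi> (r n) x) \<longlonglongrightarrow> 0"
        by (rule tendsto_rabs_zero_cancel)
      then have "(\<lambda>n. u x - (u x - \<phi> (r n) x)) \<longlonglongrightarrow> u x - 0"
        by (intro tendsto_intros)
      then have lim: "(\<lambda>n. \<alpha> * \<bar>\<phi> (r n) x\<bar>) \<longlonglongrightarrow> \<alpha> * \<bar>u x\<bar>"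
        by (intro tendsto_intros) simp
      have "isCont F (\<alpha> * \<bar>u x\<bar>)"
        using F by (simp add: continuous_on_eq_continuous_at)
      then show ?case
        by (intro tendsto_ennrealI isCont_tendsto_compose[OF _ lim])
    qed
    have "(\<integral>\<^sup>+x. ennreal (F (\<alpha> * \<bar>u x\<bar>)) \<partial>log_measure) = (\<integral>\<^sup>+x. liminf (\<lambda>n. ennreal (F (\<alpha> * \<bar>\<phi> (r n) x\<bar>))) \<partial>log_measure)"
      using AE by (intro nn_integral_cong_AE) (auto elim!: eventually_mono simp: lim_imp_Liminf)
    also have "\<dots> \<le> liminf (\<lambda>n. \<integral>\<^sup>+x. ennreal (F (\<alpha> * \<bar>\<phi> (r n) x\<bar>)) \<partial>log_measure)"
      by (intro nn_integral_liminf) simp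
    also have "\<dots> \<le> ennreal C"
      using eventually_subseq[OF r(1) bound]
      by (intro Liminf_le) auto
    finally show "(\<integral>\<^sup>+x. ennreal (F (\<alpha> * \<bar>u x\<bar>)) \<partial>log_measure) \<le> ennreal C" .
  qed
qed

section \<open>Finiteness and normalisation of the norms in the completion\<close>

lemma nn_integral_powr_add_finite:
  fixes f g d :: "'a \<Rightarrow> real"
  assumes [measurable]: "g \<in> borel_measurable M" "d \<in> borel_measurable M"
    and nonneg: "\<And>x. 0 \<le> f x" "\<And>x. 0 \<le> g x" "\<And>x. 0 \<le> d x"
    and tri: "\<And>x. f x \<le> g x + d x" and "p \<ge> 0"
    and fin: "(\<integral>\<^sup>+x. ennreal (g x powr p) \<partial>M) < \<infinity>" "(\<integral>\<^sup>+x. ennreal (d x powr p) \<partial>M) < \<infinity>"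
  shows "(\<integral>\<^sup>+x. ennreal (f x powr p) \<partial>M) < \<infinity>"
proof -
  have "(\<integral>\<^sup>+x. ennreal (f x powr p) \<partial>M) \<le> (\<integral>\<^sup>+x. ennreal (2 powr p) * ennreal (g x powr p) + ennreal (2 powr p) * ennreal (d x powr p) \<partial>M)"
  proof (rule nn_integral_mono)
    fix x
    have "f x powr p \<le> (g x + d x) powr p"
      using tri nonneg \<open>p \<ge> 0\<close> by (intro powr_mono2) auto
    also have "\<dots> \<le> 2 powr p * g x powr p + 2 powr p * d x powr p"
      using powr_add_le[of "g x" "d x" 1 p] nonneg \<open>p \<ge> 0\<close> by simp
    finally have "ennreal (f x powr p) \<le> ennreal (2 powr p * g x powr p + 2 powr p * d x powr p)"
      by (rule ennreal_leI)
    also have "\<dots> = ennreal (2 powr p) * ennreal (g x powr p) + ennreal (2 powr p) * ennreal (d x powr p)"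
      by (simp add: ennreal_mult)
    finally show "ennreal (f x powr p) \<le> \<dots>" .
  qed
  also have "\<dots> = ennreal (2 powr p) * (\<integral>\<^sup>+x. ennreal (g x powr p) \<partial>M) + ennreal (2 powr p) * (\<integral>\<^sup>+x. ennreal (d x powr p) \<partial>M)"
    by (simp add: nn_integral_add nn_integral_cmult)
  also have "\<dots> < \<infinity>"
    using fin by (simp add: ennreal_mult_less_top)
  finally show ?thesis .
qed

lemma test_function_norms_finite:
  fixes g :: "'a::euclidean_space \<Rightarrow> real"
  assumes g: "test_function g" and "q > 0"
  shows "(\<integral>\<^sup>+x. ennreal (\<bar>g x\<bar> powr q) \<partial>log_measure) < \<infinity>"
    and "(\<integral>\<^sup>+x. ennreal (norm (grad g x) powr real DIM('a)) \<partial>lebesgue) < \<infinity>"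
proof -
  obtain R where R: "R > 0" "\<And>x. norm x \<ge> R \<Longrightarrow> g x = 0" "\<And>x. norm x \<ge> R \<Longrightarrow> grad g x = 0"
    using test_function_support[OF g] by blast
  note [continuous_intros] = test_function_continuous[OF g] test_function_grad_continuous[OF g]
  note [measurable] = test_function_measurable[OF g]
  have "exp 1 + norm x > 0" for x :: 'a by (simp add: add_pos_nonneg)
  then have "exp 1 + norm x \<noteq> 0" for x :: 'a by (simp add: less_imp_neq[THEN not_sym])
  then have "continuous_on UNIV (\<lambda>x. log_weight x * \<bar>g x\<bar> powr q)"
    unfolding log_weight_def using \<open>q > 0\<close>
    by (intro continuous_intros continuous_on_powr') auto
  then have "(\<integral>\<^sup>+x. ennreal (log_weight x * \<bar>g x\<bar> powr q) \<partial>lebesgue) < \<infinity>"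
    by (rule nn_integral_compact_support_finite[of _ R]) (simp add: R)
  moreover have "ennreal (log_weight x * \<bar>g x\<bar> powr q) = ennreal (log_weight x) * ennreal (\<bar>g x\<bar> powr q)" for x
    by (simp add: ennreal_mult'')
  ultimately show "(\<integral>\<^sup>+x. ennreal (\<bar>g x\<bar> powr q) \<partial>log_measure) < \<infinity>"
    by (subst nn_integral_log_measure) simp_all
  have "continuous_on UNIV (\<lambda>x. norm (grad g x) powr real DIM('a))"
    by (intro continuous_intros continuous_on_powr') auto
  then show "(\<integral>\<^sup>+x. ennreal (norm (grad g x) powr real DIM('a)) \<partial>lebesgue) < \<infinity>"
    by (rule nn_integral_compact_support_finite[of _ R]) (simp add: R)
qed

text \<open>A single approximant at finite distance suffices, since test functions have finite
  norms.\<close>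

lemma W_space_norms_finite:
  fixes u :: "'a::euclidean_space \<Rightarrow> real"
  assumes W: "(u, G) \<in> W_space q" and "q > 0"
  shows "(\<integral>\<^sup>+x. ennreal (\<bar>u x\<bar> powr q) \<partial>log_measure) < \<infinity>"
    and "(\<integral>\<^sup>+x. ennreal (norm (G x) powr real DIM('a)) \<partial>lebesgue) < \<infinity>"
proof -
  obtain \<phi> where m [measurable]: "u \<in> borel_measurable lebesgue" "G \<in> borel_measurable lebesgue"
    and \<phi>: "\<And>n. test_function (\<phi> n)"
    and lim: "(\<lambda>n. \<integral>\<^sup>+x. ennreal (\<bar>u x - \<phi> n x\<bar> powr q) \<partial>log_measure) \<longlonglongrightarrow> 0"
      "(\<lambda>n. \<integral>\<^sup>+x. ennreal (norm (G x - grad (\<phi> n) x) powr real DIM('a)) \<partial>lebesgue) \<longlonglongrightarrow> 0"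
    using W by (rule W_spaceE) blast
  note test_function_measurable[OF \<phi>, measurable]
  note measurable_log_measure_eq[simp]
  have "\<forall>\<^sub>F n in sequentially. (\<integral>\<^sup>+x. ennreal (\<bar>u x - \<phi> n x\<bar> powr q) \<partial>log_measure) < 1 \<and>
      (\<integral>\<^sup>+x. ennreal (norm (G x - grad (\<phi> n) x) powr real DIM('a)) \<partial>lebesgue) < 1"
    by (intro eventually_conj order_tendstoD(2)[OF lim(1)] order_tendstoD(2)[OF lim(2)]) auto
  then obtain n where "(\<integral>\<^sup>+x. ennreal (\<bar>u x - \<phi> n x\<bar> powr q) \<partial>log_measure) < 1"
      "(\<integral>\<^sup>+x. ennreal (norm (G x - grad (\<phi> n) x) powr real DIM('a)) \<partial>lebesgue) < 1"
    by (auto dest: eventually_happens)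
  then have n: "(\<integral>\<^sup>+x. ennreal (\<bar>u x - \<phi> n x\<bar> powr q) \<partial>log_measure) < \<infinity>"
      "(\<integral>\<^sup>+x. ennreal (norm (G x - grad (\<phi> n) x) powr real DIM('a)) \<partial>lebesgue) < \<infinity>"
    by (simp_all only: infinity_ennreal_def order.strict_trans[OF _ ennreal_one_less_top])
  show "(\<integral>\<^sup>+x. ennreal (\<bar>u x\<bar> powr q) \<partial>log_measure) < \<infinity>"
    by (rule nn_integral_powr_add_finite[OF _ _ _ _ _ _ _ test_function_norms_finite(1)[OF \<phi>[of n]] n(1)])
       (use \<open>q > 0\<close> in auto)
  have "norm (G x) \<le> norm (grad (\<phi> n) x) + norm (G x - grad (\<phi> n) x)" for x
    by (rule norm_triangle_sub)
  then show "(\<integral>\<^sup>+x. ennreal (norm (G x) powr real DIM('a)) \<partial>lebesgue) < \<infinity>"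
    by (intro nn_integral_powr_add_finite[OF _ _ _ _ _ _ _ test_function_norms_finite(2)[OF \<phi>[of n] \<open>q > 0\<close>] n(2)])
       auto
qed

lemma W_norm_pow_le_1D:
  fixes u :: "'a::euclidean_space \<Rightarrow> real"
  assumes W: "(u, G) \<in> W_space q" and "q > 0" and le: "W_norm_pow q u G \<le> 1"
  shows "(\<integral>\<^sup>+x. ennreal (\<bar>u x\<bar> powr q) \<partial>log_measure) \<le> 1"
    and "(\<integral>\<^sup>+x. ennreal (norm (G x) powr real DIM('a)) \<partial>lebesgue) \<le> 1"
proof -
  note [simp] = measurable_log_measure_eq
  have [measurable]: "u \<in> borel_measurable lebesgue" "G \<in> borel_measurable lebesgue"
    using W by (auto simp: W_space_def)
  \<comment> \<open>Finiteness comes first: a Bochner integral defaults to 0 on a non-integrable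
    function, and a bound on \<open>W_norm_pow\<close> would then say nothing.\<close>
  note fin = W_space_norms_finite[OF W \<open>q > 0\<close>]
  define I where "I = (\<integral>x. \<bar>u x\<bar> powr q \<partial>log_measure)"
  define J where "J = (\<integral>x. norm (G x) ^ DIM('a) \<partial>lebesgue)"
  have "integrable log_measure (\<lambda>x. \<bar>u x\<bar> powr q)"
    using fin(1) by (simp add: integrable_iff_bounded)
  then have I: "(\<integral>\<^sup>+x. ennreal (\<bar>u x\<bar> powr q) \<partial>log_measure) = ennreal I"
    unfolding I_def by (intro nn_integral_eq_integral) auto
  have "integrable lebesgue (\<lambda>x. norm (G x) powr real DIM('a))"
    using fin(2) by (simp add: integrable_iff_bounded)
  then have J: "(\<integral>\<^sup>+x. ennreal (norm (G x) powr real DIM('a)) \<partial>lebesgue) = ennreal J"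
    unfolding J_def norm_powr_DIM by (intro nn_integral_eq_integral) auto
  have nonneg: "I \<ge> 0" "J \<ge> 0" by (simp_all add: I_def J_def)
  have sum: "J + I powr (real DIM('a) / q) \<le> 1"
    using le by (simp add: W_norm_pow_def I_def J_def)
  then have "J \<le> 1"
    using powr_ge_zero[of I "real DIM('a) / q"] by linarith
  then show "(\<integral>\<^sup>+x. ennreal (norm (G x) powr real DIM('a)) \<partial>lebesgue) \<le> 1"
    unfolding J by (simp add: ennreal_le_1)
  have "I \<le> 1"
  proof (rule ccontr)
    assume "\<not> I \<le> 1"
    then have "I powr (real DIM('a) / q) > 1 powr (real DIM('a) / q)"
      using \<open>q > 0\<close> by (intro powr_less_mono2) auto
    then show False using sum nonneg by simp
  qed
  then show "(\<integral>\<^sup>+x. ennreal (\<bar>u x\<bar> powr q) \<partial>log_measure) \<le> 1"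
    unfolding I by (simp add: ennreal_le_1)
qed

lemma W_space_finite:
  fixes \<alpha> q :: real and F :: "real \<Rightarrow> real" and u :: "'a::euclidean_space \<Rightarrow> real"
  assumes dim: "DIM('a) \<ge> 2" and q: "q \<ge> 1" and \<alpha>: "0 < \<alpha>"
    and F: "continuous_on UNIV F" and Fmono: "mono F"
    and F0: "\<exists>C>0. \<forall>s\<in>{0..1}. F s \<le> C * s powr q"
    and F1: "\<And>b. b > critical_alpha TYPE('a) \<Longrightarrow>
      \<exists>C>0. \<forall>s\<ge>1. F s \<le> C * exp (b * s powr (real DIM('a) / (real DIM('a) - 1)))"
    and W: "(u, G) \<in> W_space q"
  shows "(\<integral>\<^sup>+x. ennreal (F (\<alpha> * \<bar>u x\<bar>)) \<partial>log_measure) < \<infinity>"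
proof -
  obtain C where C: "\<And>(v :: 'a \<Rightarrow> real) H. (v, H) \<in> W_space q \<Longrightarrow> (\<integral>\<^sup>+y. ennreal (\<bar>v y\<bar> powr q) \<partial>log_measure) \<le> 1 \<Longrightarrow>
      (\<integral>\<^sup>+y. ennreal (norm (H y) powr real DIM('a)) \<partial>lebesgue) \<le> 1 \<Longrightarrow>
      (\<integral>\<^sup>+x. ennreal (F (1 / 2 * \<bar>v x\<bar>)) \<partial>log_measure) \<le> ennreal C"
    using W_space_uniform_bound[OF dim q _ _ F F0 F1, of "1 / 2"] by auto
  obtain \<phi> where m [measurable]: "u \<in> borel_measurable lebesgue" "G \<in> borel_measurable lebesgue"
    and \<phi>: "\<And>n. test_function (\<phi> n)"
    and lim: "(\<lambda>n. \<integral>\<^sup>+x. ennreal (\<bar>u x - \<phi> n x\<bar> powr q) \<partial>log_measure) \<longlonglongrightarrow> 0"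
      "(\<lambda>n. \<integral>\<^sup>+x. ennreal (norm (G x - grad (\<phi> n) x) powr real DIM('a)) \<partial>lebesgue) \<longlonglongrightarrow> 0"
    using W by (rule W_spaceE) blast
  note test_function_measurable[OF \<phi>, measurable]
  note measurable_log_measure_eq[simp]
  have F_meas [measurable]: "F \<in> borel_measurable borel"
    using F by (rule borel_measurable_continuous_onI)
  \<comment> \<open>Where \<open>\<alpha> \<bar>u\<bar>\<close> is large, \<open>\<bar>u\<bar> \<le> 2 \<bar>u - \<phi>\<^sub>n\<bar>\<close> since \<open>\<phi>\<^sub>n\<close> is bounded; and \<open>c (u - \<phi>\<^sub>n)\<close> has norm at most \<open>1\<close>.\<close>
  define c where "c = 4 * \<alpha>"
  have c: "c > 0" using \<alpha> by (simp add: c_def)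
  have "(\<lambda>n. ennreal (c powr q) * (\<integral>\<^sup>+x. ennreal (\<bar>u x - \<phi> n x\<bar> powr q) \<partial>log_measure)) \<longlonglongrightarrow> 0"
    "(\<lambda>n. ennreal (c powr real DIM('a)) * (\<integral>\<^sup>+x. ennreal (norm (G x - grad (\<phi> n) x) powr real DIM('a)) \<partial>lebesgue)) \<longlonglongrightarrow> 0"
    using ennreal_tendsto_cmult[OF _ lim(1), of "ennreal (c powr q)"]
      ennreal_tendsto_cmult[OF _ lim(2), of "ennreal (c powr real DIM('a))"] by simp_all
  then have "\<forall>\<^sub>F n in sequentially. ennreal (c powr q) * (\<integral>\<^sup>+x. ennreal (\<bar>u x - \<phi> n x\<bar> powr q) \<partial>log_measure) < 1 \<and>
      ennreal (c powr real DIM('a)) * (\<integral>\<^sup>+x. ennreal (norm (G x - grad (\<phi> n) x) powr real DIM('a)) \<partial>lebesgue) < 1"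
    by (intro eventually_conj order_tendstoD(2)[where y = 0]) auto
  then obtain n where n: "ennreal (c powr q) * (\<integral>\<^sup>+x. ennreal (\<bar>u x - \<phi> n x\<bar> powr q) \<partial>log_measure) \<le> 1"
      "ennreal (c powr real DIM('a)) * (\<integral>\<^sup>+x. ennreal (norm (G x - grad (\<phi> n) x) powr real DIM('a)) \<partial>lebesgue) \<le> 1"
    by (auto dest!: eventually_happens intro: less_imp_le)
  let ?v = "\<lambda>x. c * (u x - \<phi> n x)"
  have v: "(\<integral>\<^sup>+x. ennreal (F (1 / 2 * \<bar>?v x\<bar>)) \<partial>log_measure) \<le> ennreal C"
  proof (rule C[OF W_space_affine[OF W \<phi> c]])
    have "\<bar>?v x\<bar> powr q = c powr q * \<bar>u x - \<phi> n x\<bar> powr q" for x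
      using c by (subst abs_mult) (simp add: powr_mult)
    then show "(\<integral>\<^sup>+x. ennreal (\<bar>?v x\<bar> powr q) \<partial>log_measure) \<le> 1"
      using n(1) by (simp add: ennreal_mult nn_integral_cmult)
    have "norm (c *\<^sub>R (G x - grad (\<phi> n) x)) powr real DIM('a) = c powr real DIM('a) * norm (G x - grad (\<phi> n) x) powr real DIM('a)" for x
      using c by (subst norm_scaleR) (auto intro: powr_mult simp del: powr_realpow powr_numeral)
    then show "(\<integral>\<^sup>+x. ennreal (norm (c *\<^sub>R (G x - grad (\<phi> n) x)) powr real DIM('a)) \<partial>lebesgue) \<le> 1"
      using n(2) by (simp only: ennreal_mult powr_ge_zero) (simp add: nn_integral_cmult)
  qed
  obtain R where R: "\<And>x. norm x \<ge> R \<Longrightarrow> \<phi> n x = 0"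
    using test_function_support[OF \<phi>] by blast
  have "compact (\<phi> n ` cball 0 R)"
    by (intro compact_continuous_image continuous_on_subset[OF test_function_continuous[OF \<phi>]]) auto
  then have "bounded (\<phi> n ` cball 0 R)" by (rule compact_imp_bounded)
  then obtain B where "B > 0" and "\<forall>y\<in>\<phi> n ` cball 0 R. norm y \<le> B"
    unfolding bounded_pos by blast
  then have B: "\<bar>\<phi> n x\<bar> \<le> B" for x
    using R[of x] \<open>B > 0\<close> by (cases "norm x \<le> R") auto
  \<comment> \<open>Up to \<open>K\<close>, monotonicity and the bound near 0 give F(s) \<le> D s^q.
    Beyond it |u| \<ge> 2 B, so the bounded test function accounts for at most half of |u|.\<close>
  define K where "K = max 1 (2 * \<alpha> * B)"
  obtain C1 where C1: "C1 > 0" "\<And>s. s \<in> {0..1} \<Longrightarrow> F s \<le> C1 * s powr q" using F0 by blast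
  define D where "D = C1 + \<bar>F K\<bar>"
  have D: "D \<ge> 0" using C1 by (simp add: D_def)
  have FK: "F s \<le> D * s powr q" if "0 \<le> s" "s \<le> K" for s
  proof (cases "s \<le> 1")
    case True
    then have "F s \<le> C1 * s powr q" using that by (intro C1) auto
    also have "\<dots> \<le> D * s powr q" by (intro mult_right_mono) (auto simp: D_def)
    finally show ?thesis .
  next
    case False
    have "F s \<le> F K" using that by (intro monoD[OF Fmono])
    also have "\<dots> \<le> D * 1" using C1 by (simp add: D_def)
    also have "\<dots> \<le> D * s powr q"
      using False q D by (intro mult_left_mono) (auto intro: ge_one_powr_ge_zero)
    finally show ?thesis .
  qed
  have pt: "ennreal (F (\<alpha> * \<bar>u x\<bar>)) \<le> ennreal (D * \<alpha> powr q) * ennreal (\<bar>u x\<bar> powr q) + ennreal (F (1 / 2 * \<bar>?v x\<bar>))" for x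
  proof (cases "\<alpha> * \<bar>u x\<bar> \<le> K")
    case True
    have "F (\<alpha> * \<bar>u x\<bar>) \<le> D * (\<alpha> * \<bar>u x\<bar>) powr q"
      using True \<alpha> by (intro FK) auto
    also have "\<dots> = D * \<alpha> powr q * \<bar>u x\<bar> powr q"
      using \<alpha> by (simp add: powr_mult)
    finally have "ennreal (F (\<alpha> * \<bar>u x\<bar>)) \<le> ennreal (D * \<alpha> powr q) * ennreal (\<bar>u x\<bar> powr q)"
      using D by (subst ennreal_mult[symmetric]) (auto intro: ennreal_leI)
    then show ?thesis by (rule order.trans) (simp only: add_increasing add_increasing2 order_refl zero_le)
  next
    case False
    then have "2 * \<alpha> * B \<le> \<alpha> * \<bar>u x\<bar>" by (simp add: K_def)
    then have "2 * B \<le> \<bar>u x\<bar>" using \<alpha> by simp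
    moreover have "\<bar>u x\<bar> \<le> \<bar>u x - \<phi> n x\<bar> + \<bar>\<phi> n x\<bar>" by simp
    moreover have "U \<le> 2 * d" if "2 * B \<le> U" "U \<le> d + p" "p \<le> B" for U d p
      using that by linarith
    ultimately have "\<bar>u x\<bar> \<le> 2 * \<bar>u x - \<phi> n x\<bar>" using B[of x] by blast
    \<comment> \<open>The factor c = 4 \<alpha> combines the 2 from the previous inequality with the
      2 that compensates the sample value 1/2 in the uniform bound.\<close>
    then have "\<alpha> * \<bar>u x\<bar> \<le> 1 / 2 * \<bar>?v x\<bar>"
      using \<alpha> by (subst abs_mult) (simp add: c_def)
    then have "ennreal (F (\<alpha> * \<bar>u x\<bar>)) \<le> ennreal (F (1 / 2 * \<bar>?v x\<bar>))"
      by (intro ennreal_leI monoD[OF Fmono])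
    then show ?thesis by (rule order.trans) (simp only: add_increasing add_increasing2 order_refl zero_le)
  qed
  have "(\<integral>\<^sup>+x. ennreal (F (\<alpha> * \<bar>u x\<bar>)) \<partial>log_measure) \<le>
      (\<integral>\<^sup>+x. ennreal (D * \<alpha> powr q) * ennreal (\<bar>u x\<bar> powr q) + ennreal (F (1 / 2 * \<bar>?v x\<bar>)) \<partial>log_measure)"
    by (intro nn_integral_mono pt)
  also have "\<dots> = ennreal (D * \<alpha> powr q) * (\<integral>\<^sup>+x. ennreal (\<bar>u x\<bar> powr q) \<partial>log_measure) + (\<integral>\<^sup>+x. ennreal (F (1 / 2 * \<bar>?v x\<bar>)) \<partial>log_measure)"
    by (subst nn_integral_add) (simp_all add: nn_integral_cmult)
  also have "\<dots> < \<infinity>"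
    using W_space_norms_finite(1)[OF W] q v
    by (auto simp: ennreal_mult_less_top intro: le_less_trans)
  finally show ?thesis .
qed

theorem theorem3p3:
  fixes N :: nat and q :: real and f F :: "real \<Rightarrow> real"
  assumes "N = DIM('a::euclidean_space)" and "N \<ge> 3" and "q > real N"
    and "cond_f1 N (critical_alpha TYPE('a)) q f"
    and "\<And>s. F s = (LBINT \<tau>=0..s. f \<tau>)"
  shows "(\<forall>(u, G) \<in> (W_space q :: (('a \<Rightarrow> real) \<times> ('a \<Rightarrow> 'a)) set).
            u \<in> orlicz_space log_measure F)
    \<and> (\<forall>(u, G) \<in> (W_space q :: (('a \<Rightarrow> real) \<times> ('a \<Rightarrow> 'a)) set). \<forall>\<alpha>>0.
            (\<integral>\<^sup>+x. ennreal (F (\<alpha> * \<bar>u x\<bar>)) \<partial>log_measure) < \<infinity>)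
    \<and> (\<forall>\<alpha>. 0 < \<alpha> \<and> \<alpha> < real N / q * (real N / (real N + 1)) powr (1 / real N) \<longrightarrow>
          (SUP (u, G) \<in> {(u, G) \<in> (W_space q :: (('a \<Rightarrow> real) \<times> ('a \<Rightarrow> 'a)) set).
                          W_norm_pow q u G \<le> 1}.
             \<integral>\<^sup>+x. ennreal (F (\<alpha> * \<bar>u x\<bar>)) \<partial>log_measure) < \<infinity>)"
proof -
  note f = assms(4,5)
  have dim: "DIM('a) \<ge> 2" and q: "q \<ge> 1" "q > 1" "q > 0"
    using assms(1-3) by auto
  have cont: "continuous_on UNIV F" by (rule primitive_continuous[OF f])
  have mono: "mono F" by (intro monoI primitive_mono[OF f])
  have F0: "\<exists>C>0. \<forall>s\<in>{0..1}. F s \<le> C * s powr q"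
    by (rule primitive_le_near_0[OF f q(2)])
  have F1: "\<exists>C>0. \<forall>s\<ge>1. F s \<le> C * exp (b * s powr (real DIM('a) / (real DIM('a) - 1)))"
    if "b > critical_alpha TYPE('a)" for b
    using primitive_le_exp[OF f _ _ that] assms(1,2) by (simp add: critical_alpha_eq)
  have fin: "(\<integral>\<^sup>+x. ennreal (F (\<alpha> * \<bar>u x\<bar>)) \<partial>log_measure) < \<infinity>"
    if "(u, G) \<in> W_space q" "\<alpha> > 0" for u :: "'a \<Rightarrow> real" and G \<alpha>
    by (rule W_space_finite[OF dim q(1) that(2) cont mono F0 F1 that(1)])
  show ?thesis
  proof (intro conjI allI impI)
    show "\<forall>(u, G) \<in> (W_space q :: (('a \<Rightarrow> real) \<times> ('a \<Rightarrow> 'a)) set). u \<in> orlicz_space log_measure F"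
    proof clarify
      fix u :: "'a \<Rightarrow> real" and G assume W: "(u, G) \<in> W_space q"
      then have "u \<in> borel_measurable log_measure"
        unfolding measurable_log_measure_eq by (auto simp: W_space_def)
      then show "u \<in> orlicz_space log_measure F"
        unfolding orlicz_space_def using fin[OF W zero_less_one] by (auto intro!: exI[of _ 1])
    qed
    show "\<forall>(u, G) \<in> (W_space q :: (('a \<Rightarrow> real) \<times> ('a \<Rightarrow> 'a)) set). \<forall>\<alpha>>0.
            (\<integral>\<^sup>+x. ennreal (F (\<alpha> * \<bar>u x\<bar>)) \<partial>log_measure) < \<infinity>"
      using fin by blast
    fix \<alpha> :: real
    assume \<alpha>: "0 < \<alpha> \<and> \<alpha> < real N / q * (real N / (real N + 1)) powr (1 / real N)"
    \<comment> \<open>Both factors of the threshold are at most 1, so every admissible \<alpha> lies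
      in the range of \<open>W_space_uniform_bound\<close>.\<close>
    have "(real N / (real N + 1)) powr (1 / real N) \<le> 1"
      by (intro powr_le1) auto
    then have "real N / q * (real N / (real N + 1)) powr (1 / real N) \<le> 1 * 1"
      using assms(3) q by (intro mult_mono) auto
    then have "\<alpha> < 1" using \<alpha> by linarith
    then obtain C where C: "\<And>(u :: 'a \<Rightarrow> real) G. (u, G) \<in> W_space q \<Longrightarrow> (\<integral>\<^sup>+y. ennreal (\<bar>u y\<bar> powr q) \<partial>log_measure) \<le> 1 \<Longrightarrow>
        (\<integral>\<^sup>+y. ennreal (norm (G y) powr real DIM('a)) \<partial>lebesgue) \<le> 1 \<Longrightarrow>
        (\<integral>\<^sup>+x. ennreal (F (\<alpha> * \<bar>u x\<bar>)) \<partial>log_measure) \<le> ennreal C"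
      using W_space_uniform_bound[OF dim q(1) _ _ cont F0 F1, of \<alpha>] \<alpha> by auto
    have "(SUP (u, G) \<in> {(u, G) \<in> (W_space q :: (('a \<Rightarrow> real) \<times> ('a \<Rightarrow> 'a)) set). W_norm_pow q u G \<le> 1}.
             \<integral>\<^sup>+x. ennreal (F (\<alpha> * \<bar>u x\<bar>)) \<partial>log_measure) \<le> ennreal C"
      by (rule SUP_least) (auto intro!: C W_norm_pow_le_1D q(3))
    also have "\<dots> < \<infinity>" by simp
    finally show "(SUP (u, G) \<in> {(u, G) \<in> (W_space q :: (('a \<Rightarrow> real) \<times> ('a \<Rightarrow> 'a)) set). W_norm_pow q u G \<le> 1}.
             \<integral>\<^sup>+x. ennreal (F (\<alpha> * \<bar>u x\<bar>)) \<partial>log_measure) < \<infinity>" .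
  qed
qed

end
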